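(* Let $k \ge 3$ be a fixed integer. There is an algorithm which, given a directed graph $G=(V,E)$ with $n=|V|$ vertices and $m=|E|$ edges, runs in $O(nm)$ time and returns a $k$-path partition $\mathcal{Q}$ of $G$ such that $|\mathcal{Q}| \le \frac{k}{2}\,|\mathcal{Q}^*|$, where $\mathcal{Q}^*$ is a $k$-path partition of $G$ with the minimum number of paths. That is, the $k$-path partition problem on directed graphs admits an $O(nm)$-time $k/2$-approximation algorithm.
   Context: All graphs are directed, without self-loops or multiple edges. A path is a simple directed path, i.e. a sequence of distinct vertices such that there is an edge from each vertex to the next one; a single vertex is a path. The order of a path is its number of vertices; a $j$-path is a path of order $j$. Given a directed graph $G=(V,E)$ and a positive integer $k$, a $k$-path partition of $G$ is a collection of vertex-disjoint paths of $G$, each of order at most $k$, such that every vertex of $V$ lies on some path of the collection; its size $|\mathcal{Q}|$ is the number of paths. The $k$-path partition problem ($k$PP) asks for a $k$-path partition of minimum size. An algorithm is a $\rho$-approximation if it always returns a $k$-path partition of size at most $\rho$ times the minimum size. *)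

theory Defs
  imports Complex_Main "Graph_Theory.Graph_Theory"
begin

section \<open>Path partitions\<close>

text \<open>
  A simple directed path is a \<^const>\<open>vpath\<close>: a nonempty list of distinct vertices, each joined
  to the next by an arc; its order is its length.
\<close>

definition k_path_partition :: "nat \<Rightarrow> ('a, 'b) pre_digraph \<Rightarrow> 'a list set \<Rightarrow> bool" where
  "k_path_partition k G Q \<longleftrightarrow>
     (\<forall>p\<in>Q. vpath p G \<and> length p \<le> k) \<and>
     (\<forall>p\<in>Q. \<forall>q\<in>Q. p \<noteq> q \<longrightarrow> set p \<inter> set q = {}) \<and>
     (\<forall>v\<in>verts G. \<exists>p\<in>Q. v \<in> set p)"

text \<open>In a finite digraph every path partition is a finite set, so \<^const>\<open>card\<close> counts its paths.\<close>

definition min_k_path_partition :: "nat \<Rightarrow> ('a, 'b) pre_digraph \<Rightarrow> 'a list set \<Rightarrow> bool" where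
  "min_k_path_partition k G Q \<longleftrightarrow>
     k_path_partition k G Q \<and> (\<forall>Q'. k_path_partition k G Q' \<longrightarrow> card Q \<le> card Q')"


section \<open>Machine model\<close>

text \<open>
  Running time is measured on a word RAM, programmed in a small imperative language over natural
  numbers with finitely many (named) scalar registers and arrays. Subtraction is truncated.
\<close>

type_synonym vname = string

record store =
  reg :: "vname \<Rightarrow> nat"
  arr :: "vname \<Rightarrow> nat \<Rightarrow> nat"

datatype aexp =
    Const nat
  | Reg vname
  | Read vname aexp
  | Add aexp aexp
  | Sub aexp aexp

datatype bexp =
    Less aexp aexp
  | Equal aexp aexp
  | Neg bexp
  | Conj bexp bexp

datatype com =
    Skip
  | Assign vname aexp
  | Write vname aexp aexp
  | Seq com com
  | Cond bexp com com
  | While bexp com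

fun aval :: "aexp \<Rightarrow> store \<Rightarrow> nat" where
  "aval (Const c) s = c"
| "aval (Reg x) s = reg s x"
| "aval (Read a e) s = arr s a (aval e s)"
| "aval (Add e f) s = aval e s + aval f s"
| "aval (Sub e f) s = aval e s - aval f s"

fun bval :: "bexp \<Rightarrow> store \<Rightarrow> bool" where
  "bval (Less e f) s \<longleftrightarrow> aval e s < aval f s"
| "bval (Equal e f) s \<longleftrightarrow> aval e s = aval f s"
| "bval (Neg b) s \<longleftrightarrow> \<not> bval b s"
| "bval (Conj b c) s \<longleftrightarrow> bval b s \<and> bval c s"

text \<open>
  \<open>exec W c s t s'\<close>: started in \<open>s\<close>, the program \<open>c\<close> terminates in \<open>s'\<close> after \<open>t\<close> steps, and every
  value stored and every array index written is below the word bound \<open>W\<close> (otherwise the execution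
  is stuck). Evaluating an expression counts as part of a single step; since the expressions of a
  program have a fixed size, this matters only for the constant factor, and intermediate values
  stay within a constant factor of \<open>W\<close>.
\<close>

inductive exec :: "nat \<Rightarrow> com \<Rightarrow> store \<Rightarrow> nat \<Rightarrow> store \<Rightarrow> bool" for W where
  Skip: "exec W Skip s 1 s"
| Assign: "aval e s < W \<Longrightarrow>
    exec W (Assign x e) s 1 (s\<lparr>reg := (reg s)(x := aval e s)\<rparr>)"
| Write: "aval i s < W \<Longrightarrow> aval e s < W \<Longrightarrow>
    exec W (Write a i e) s 1 (s\<lparr>arr := (arr s)(a := (arr s a)(aval i s := aval e s))\<rparr>)"
| Seq: "exec W c s t s' \<Longrightarrow> exec W d s' u s'' \<Longrightarrow> exec W (Seq c d) s (t + u) s''"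
| CondTrue: "bval b s \<Longrightarrow> exec W c s t s' \<Longrightarrow> exec W (Cond b c d) s (1 + t) s'"
| CondFalse: "\<not> bval b s \<Longrightarrow> exec W d s t s' \<Longrightarrow> exec W (Cond b c d) s (1 + t) s'"
| WhileFalse: "\<not> bval b s \<Longrightarrow> exec W (While b c) s 1 s"
| WhileTrue: "bval b s \<Longrightarrow> exec W c s t s' \<Longrightarrow> exec W (While b c) s' u s'' \<Longrightarrow>
    exec W (While b c) s (1 + t + u) s''"

lemma exec_deterministic:
  "exec W c s t s' \<Longrightarrow> exec W c s u s'' \<Longrightarrow> u = t \<and> s'' = s'"
proof (induction arbitrary: u s'' rule: exec.induct)
  case Skip
  then show ?case by cases auto
next
  case Assign
  from Assign.prems show ?case by cases auto
next
  case Write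
  from Write.prems show ?case by cases auto
next
  case Seq
  from Seq.prems show ?case by cases (use Seq.IH in blast)
next
  case CondTrue
  from CondTrue.prems show ?case by cases (use CondTrue.IH CondTrue.hyps in blast)+
next
  case CondFalse
  from CondFalse.prems show ?case by cases (use CondFalse.IH CondFalse.hyps in blast)+
next
  case WhileFalse
  from WhileFalse.prems show ?case by cases (use WhileFalse.hyps in blast)+
next
  case WhileTrue
  from WhileTrue.prems show ?case by cases (use WhileTrue.IH WhileTrue.hyps in blast)+
qed


section \<open>Input and output of graph algorithms\<close>

text \<open>
  The input graph has vertices \<open>0, \<dots>, n - 1\<close> and is given as a plain list of its arcs, in two
  arrays holding their tails and heads. All other memory is initially zero.
\<close>

definition arcs_listing :: "nat pair_pre_digraph \<Rightarrow> (nat \<times> nat) list \<Rightarrow> bool" where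
  "arcs_listing G es \<longleftrightarrow> distinct es \<and> set es = parcs G"

definition input_store :: "nat \<Rightarrow> (nat \<times> nat) list \<Rightarrow> store" where
  "input_store n es =
     \<lparr>reg = (\<lambda>_. 0)(''n'' := n, ''m'' := length es),
      arr = (\<lambda>_ _. 0)
        (''tail'' := (\<lambda>i. if i < length es then fst (es ! i) else 0),
         ''head'' := (\<lambda>i. if i < length es then snd (es ! i) else 0))\<rparr>"

text \<open>
  The output is a list of vertex lists, written one after the other into the array \<open>out\<close>; the
  \<open>i\<close>-th of them occupies the cells from \<open>start[i]\<close> up to, but excluding, \<open>start[i + 1]\<close>, and the
  register \<open>count\<close> holds their number.
\<close>

definition output_paths :: "store \<Rightarrow> nat list list" where
  "output_paths s =
     map (\<lambda>i. map (arr s ''out'') [arr s ''start'' i ..< arr s ''start'' (i + 1)])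
       [0 ..< reg s ''count'']"

end

(*
  Let s be the least number of one-vertex paths in any path partition. If a partition into paths
  of order 1, 2 or 3 has at most s one-vertex paths, then its size is at most (n + s) / 2; and
  n + s <= k |Q| for every k-path partition Q, because a one-vertex path of Q can be counted
  twice for k >= 2.

  Such a partition comes from a bipartite matching. Every vertex w offers two slots, one for the
  arc into w and one for the arc out of w, and a vertex v may take a slot of a neighbour via the arc
  between them. The vertices on the longer paths of a partition can be matched simultaneously, so a
  maximum matching misses at most s vertices. The matched in-slots and the matched out-slots form
  two matchings between tails and heads of arcs; the exchange argument of Mendelsohn and Dulmage
  merges them into paths and cycles in which every matched vertex has a neighbour. Deleting arcs
  whose tail has a predecessor and whose head has a successor then leaves paths of order at most 3
  and isolates no vertex.

  A maximum matching is found in time O(nm) by deferred acceptance: each vertex carries a label at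
  most n + 2, proposes along its adjacency list to slots whose owner has a smaller label, and
  increases its label when the list is exhausted. So each list is scanned O(n) times.
*)
theory Submission
  imports Defs
begin

section \<open>Total correctness with time credits\<close>

text \<open>The postcondition receives the final store and the credits left over from \<open>T\<close>.\<close>

definition wp :: "nat \<Rightarrow> com \<Rightarrow> (store \<Rightarrow> nat \<Rightarrow> bool) \<Rightarrow> store \<Rightarrow> nat \<Rightarrow> bool" where
  "wp W c Q s T \<longleftrightarrow> (\<exists>t s'. exec W c s t s' \<and> t \<le> T \<and> Q s' (T - t))"

inductive_cases exec_AssignE: "exec W (Assign x e) s t s'"
inductive_cases exec_WriteE: "exec W (Write a i e) s t s'"
inductive_cases exec_SeqE: "exec W (Seq c d) s t s'"
inductive_cases exec_SkipE: "exec W Skip s t s'"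

text \<open>The rules for commands without loops are equivalences declared as simp rules. The
  simplifier can thus execute straight-line code symbolically, leaving bounds on the stored values
  and on the credits.\<close>

lemma wp_Skip [simp]: "wp W Skip Q s T \<longleftrightarrow> 1 \<le> T \<and> Q s (T - 1)"
  unfolding wp_def by (metis exec.Skip exec_SkipE)

lemma wp_Assign [simp]:
  "wp W (Assign x e) Q s T \<longleftrightarrow>
    aval e s < W \<and> 1 \<le> T \<and> Q (s\<lparr>reg := (reg s)(x := aval e s)\<rparr>) (T - 1)"
  proof
  show "wp W (Assign x e) Q s T \<Longrightarrow> aval e s < W \<and> 1 \<le> T \<and>
      Q (s\<lparr>reg := (reg s)(x := aval e s)\<rparr>) (T - 1)"
    unfolding wp_def by (auto elim!: exec_AssignE)
qed (unfold wp_def, blast intro: exec.Assign)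

lemma wp_Write [simp]:
  "wp W (Write a i e) Q s T \<longleftrightarrow>
    aval i s < W \<and> aval e s < W \<and> 1 \<le> T \<and>
    Q (s\<lparr>arr := (arr s)(a := (arr s a)(aval i s := aval e s))\<rparr>) (T - 1)"
  proof
  show "wp W (Write a i e) Q s T \<Longrightarrow> aval i s < W \<and> aval e s < W \<and> 1 \<le> T \<and>
      Q (s\<lparr>arr := (arr s)(a := (arr s a)(aval i s := aval e s))\<rparr>) (T - 1)"
    unfolding wp_def by (auto elim!: exec_WriteE)
qed (unfold wp_def, blast intro: exec.Write)

lemma wp_Seq [simp]: "wp W (Seq c d) Q s T \<longleftrightarrow> wp W c (wp W d Q) s T"
proof
  assume "wp W (Seq c d) Q s T"
  then obtain t s' where 1: "exec W (Seq c d) s t s'" "t \<le> T" "Q s' (T - t)"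
    unfolding wp_def by blast
  from 1(1) obtain t1 t2 s1 where 2: "t = t1 + t2" "exec W c s t1 s1" "exec W d s1 t2 s'"
    by (rule exec_SeqE)
  show "wp W c (wp W d Q) s T"
    unfolding wp_def using 1 2 by (metis add_leD1 diff_diff_left le_diff_conv2 add.commute)
next
  assume "wp W c (wp W d Q) s T"
  then obtain t1 s1 t2 s2 where 1: "exec W c s t1 s1" "t1 \<le> T"
    "exec W d s1 t2 s2" "t2 \<le> T - t1" "Q s2 (T - t1 - t2)"
    unfolding wp_def by blast
  show "wp W (Seq c d) Q s T"
    unfolding wp_def using 1 by (intro exI[of _ "t1 + t2"] exI[of _ s2]) (auto intro: exec.Seq)
qed

lemma wp_Cond [simp]:
  "wp W (Cond b c d) Q s T \<longleftrightarrow> 1 \<le> T \<and>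
    (bval b s \<longrightarrow> wp W c Q s (T - 1)) \<and> (\<not> bval b s \<longrightarrow> wp W d Q s (T - 1))"
proof
  assume "wp W (Cond b c d) Q s T"
  then obtain t s' where 1: "exec W (Cond b c d) s t s'" "t \<le> T" "Q s' (T - t)"
    unfolding wp_def by blast
  show "1 \<le> T \<and> (bval b s \<longrightarrow> wp W c Q s (T - 1)) \<and> (\<not> bval b s \<longrightarrow> wp W d Q s (T - 1))"
    using 1(1) by cases
      (use 1 in \<open>auto simp: wp_def intro!: exI[of _ "t - 1"] exI[of _ s']\<close>)
next
  assume *: "1 \<le> T \<and> (bval b s \<longrightarrow> wp W c Q s (T - 1)) \<and> (\<not> bval b s \<longrightarrow> wp W d Q s (T - 1))"
  show "wp W (Cond b c d) Q s T"
  proof (cases "bval b s")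
    case True
    with * obtain t s' where "exec W c s t s'" "t \<le> T - 1" "Q s' (T - 1 - t)"
      by (auto simp: wp_def)
    with True * show ?thesis unfolding wp_def
      by (intro exI[of _ "1 + t"] exI[of _ s']) (auto intro: CondTrue[simplified])
  next
    case False
    with * obtain t s' where "exec W d s t s'" "t \<le> T - 1" "Q s' (T - 1 - t)"
      by (auto simp: wp_def)
    with False * show ?thesis unfolding wp_def
      by (intro exI[of _ "1 + t"] exI[of _ s']) (auto intro: CondFalse[simplified])
  qed
qed

lemma wp_mono: "wp W c P s T \<Longrightarrow> (\<And>s' T'. P s' T' \<Longrightarrow> Q s' T') \<Longrightarrow> wp W c Q s T"
  unfolding wp_def by blast

text \<open>No variant is needed: every iteration uses up credits.\<close>

lemma wp_While:
  assumes "I s T"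
    and "\<And>s T. I s T \<Longrightarrow> 1 \<le> T"
    and "\<And>s T. I s T \<Longrightarrow> bval b s \<Longrightarrow> wp W c I s (T - 1)"
    and "\<And>s T. I s T \<Longrightarrow> \<not> bval b s \<Longrightarrow> Q s (T - 1)"
  shows "wp W (While b c) Q s T"
  using assms(1)
proof (induction T arbitrary: s rule: less_induct)
  case (less T)
  have T: "1 \<le> T" using assms(2) less.prems .
  show ?case
  proof (cases "bval b s")
    case True
    from assms(3)[OF less.prems True] obtain t s1 where
      1: "exec W c s t s1" "t \<le> T - 1" "I s1 (T - 1 - t)" unfolding wp_def by blast
    have "T - 1 - t < T" using T by simp
    from less.IH[OF this 1(3)] obtain u s2 where
      2: "exec W (While b c) s1 u s2" "u \<le> T - 1 - t" "Q s2 (T - 1 - t - u)"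
      unfolding wp_def by blast
    from True 1 2 T show ?thesis unfolding wp_def
      by (intro exI[of _ "1 + t + u"] exI[of _ s2]) (auto intro: WhileTrue[simplified])
  next
    case False
    with assms(4)[OF less.prems False] T show ?thesis unfolding wp_def
      by (intro exI[of _ 1] exI[of _ s]) (auto intro: WhileFalse[simplified])
  qed
qed

section \<open>Deferred acceptance\<close>

locale slot_graph =
  fixes n M :: nat and vt sl :: "nat \<Rightarrow> nat"
  assumes vt_range: "c \<in> {1..M} \<Longrightarrow> vt c \<in> {1..n}"
begin

text \<open>Cell \<open>0\<close> is the null pointer. The list of \<open>v\<close> visits its cells
  in descending order: its head is \<open>prev v (Suc M)\<close>, and the entry after a cell
  \<open>c\<close> of \<open>v\<close> is \<open>prev v c\<close>. The linked lists are thus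
  described pointwise, without an inductive predicate.\<close>

definition prev :: "nat \<Rightarrow> nat \<Rightarrow> nat" where
  "prev v c = Max (insert 0 {c'. 0 < c' \<and> c' < c \<and> vt c' = v})"

lemma prev_cases: "prev v c = 0 \<or> 0 < prev v c \<and> prev v c < c \<and> vt (prev v c) = v"
proof -
  have "prev v c \<in> insert 0 {c'. 0 < c' \<and> c' < c \<and> vt c' = v}"
    unfolding prev_def by (rule Max_in) auto
  then show ?thesis by auto
qed

lemma prev_ge: "0 < c' \<Longrightarrow> c' < c \<Longrightarrow> vt c' = v \<Longrightarrow> c' \<le> prev v c"
  unfolding prev_def by (rule Max_ge) auto

lemma prev_0: "prev v (Suc 0) = 0"
  using prev_cases[of v "Suc 0"] by auto

text \<open>This is insertion at the front: \<open>c\<close> becomes the head of the list of its own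
  vertex and leaves the other lists alone.\<close>

lemma prev_Suc: "0 < c \<Longrightarrow> prev v (Suc c) = (if vt c = v then c else prev v c)"
proof -
  assume c: "0 < c"
  have *: "{c'. 0 < c' \<and> c' < Suc c \<and> vt c' = v} =
    (if vt c = v then insert c else id) {c'. 0 < c' \<and> c' < c \<and> vt c' = v}"
    using c by (auto simp: less_Suc_eq)
  show ?thesis
  proof (cases "vt c = v")
    case True
    have "prev v (Suc c) = c"
      unfolding prev_def * using True c by (intro Max_eqI) auto
    with True show ?thesis by simp
  next
    case False
    then show ?thesis unfolding prev_def * by simp
  qed
qed

definition deg :: "nat \<Rightarrow> nat" where
  "deg v = card {c \<in> {1..M}. vt c = v}"

text \<open>The length of the part of the list still to be scanned when the pointer stands at cell
  \<open>p\<close>.\<close>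

definition rest :: "nat \<Rightarrow> nat \<Rightarrow> nat" where
  "rest v p = card {c \<in> {1..p}. vt c = v}"

lemma sum_deg: "(\<Sum>v\<in>{1..n}. deg v) = M"
proof -
  have "(\<Sum>v\<in>{1..n}. deg v) = card (\<Union>v\<in>{1..n}. {c \<in> {1..M}. vt c = v})"
    unfolding deg_def by (rule card_UN_disjoint[symmetric]) auto
  also have "(\<Union>v\<in>{1..n}. {c \<in> {1..M}. vt c = v}) = {1..M}"
    using vt_range by auto
  finally show ?thesis by simp
qed

lemma rest_le: "p \<le> M \<Longrightarrow> rest v p \<le> deg v"
  unfolding rest_def deg_def by (rule card_mono) auto

lemma rest_prev: "p \<noteq> 0 \<Longrightarrow> vt p = v \<Longrightarrow> rest v (prev v p) < rest v p"
proof -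
  assume p: "p \<noteq> 0" "vt p = v"
  have "prev v p < p" using prev_cases[of v p] p(1) by auto
  then have "{c \<in> {1..prev v p}. vt c = v} \<subseteq> {c \<in> {1..p}. vt c = v}"
    and "p \<in> {c \<in> {1..p}. vt c = v}" "p \<notin> {c \<in> {1..prev v p}. vt c = v}"
    using p by auto
  then have "{c \<in> {1..prev v p}. vt c = v} \<subset> {c \<in> {1..p}. vt c = v}" by blast
  then show ?thesis unfolding rest_def by (rule psubset_card_mono[rotated]) simp
qed

section \<open>Labels, the stability invariant and the potential\<close>

definition levels :: nat where "levels = n + 2"

text \<open>
  A vertex labelled \<open>d v\<close> proposes to its slots from the last cell down to the cell \<open>ptr v\<close>; a slot
  is worth the label of its owner, a free slot being owned by \<open>0\<close>.
\<close>

definition stable :: "(nat \<Rightarrow> nat) \<Rightarrow> (nat \<Rightarrow> nat) \<Rightarrow> (nat \<Rightarrow> nat) \<Rightarrow> bool" where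
  "stable own d ptr \<longleftrightarrow>
     d 0 = 0 \<and> (\<forall>v. d v \<le> levels) \<and>
     (\<forall>a. own a \<noteq> 0 \<longrightarrow> (\<exists>c\<in>{1..M}. sl c = a \<and> vt c = own a) \<and> 0 < d (own a)) \<and>
     (\<forall>a. d (own a) < levels) \<and>
     (\<forall>a b. own a = own b \<longrightarrow> own a \<noteq> 0 \<longrightarrow> a = b) \<and>
     (\<forall>c\<in>{1..M}. d (vt c) \<le> Suc (d (own (sl c)))) \<and>
     (\<forall>c\<in>{1..M}. ptr (vt c) < c \<longrightarrow> d (vt c) \<le> d (own (sl c))) \<and>
     (\<forall>v. ptr v = 0 \<or> ptr v \<in> {1..M} \<and> vt (ptr v) = v)"

text \<open>Vertices enter one at a time; \<open>i\<close> is the next to enter and \<open>x\<close>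
  the only one currently looking for a slot, \<open>0\<close> standing for none. The top label
  \<open>levels\<close> records that a vertex has given up.\<close>

definition active :: "(nat \<Rightarrow> nat) \<Rightarrow> (nat \<Rightarrow> nat) \<Rightarrow> (nat \<Rightarrow> nat) \<Rightarrow> nat \<Rightarrow> nat \<Rightarrow> bool" where
  "active own d ptr i x \<longleftrightarrow> stable own d ptr \<and> (\<forall>v\<ge>i. d v = 0) \<and>
     (x \<noteq> 0 \<longrightarrow> x < i \<and> x \<in> vt ` {1..M} \<and> x \<notin> range own \<and> d x < levels) \<and>
     (\<forall>v. 0 < v \<and> v < i \<and> v \<noteq> x \<and> v \<notin> range own \<and> v \<in> vt ` {1..M} \<longrightarrow> d v = levels)"

text \<open>The factor 2 lets a relabelling pay for its rescan: raising \<open>d v\<close> releases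
  \<open>2 * deg v\<close>, while resetting the pointer to the head of the list adds at most
  \<open>deg v\<close>. Advancing the pointer lowers \<open>rest\<close>.\<close>

definition work :: "(nat \<Rightarrow> nat) \<Rightarrow> (nat \<Rightarrow> nat) \<Rightarrow> nat" where
  "work d ptr = (\<Sum>v\<in>{1..n}. 2 * deg v * (levels - d v) + rest v (ptr v))"

lemma work_init: "work (\<lambda>_. 0) (\<lambda>_. 0) = 2 * M * levels"
proof -
  have "work (\<lambda>_. 0) (\<lambda>_. 0) = (\<Sum>v\<in>{1..n}. deg v) * (2 * levels)"
    unfolding work_def rest_def sum_distrib_right by (simp add: mult_ac)
  then show ?thesis unfolding sum_deg by simp
qed

lemma work_decreases:
  assumes "x \<in> {1..n}" "\<And>v. v \<noteq> x \<Longrightarrow> d' v = d v \<and> ptr' v = ptr v"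
    and "2 * deg x * (levels - d' x) + rest x (ptr' x) < 2 * deg x * (levels - d x) + rest x (ptr x)"
  shows "work d' ptr' < work d ptr"
  unfolding work_def
proof (rule sum_strict_mono_ex1)
  show "\<forall>v\<in>{1..n}. 2 * deg v * (levels - d' v) + rest v (ptr' v)
      \<le> 2 * deg v * (levels - d v) + rest v (ptr v)"
  proof
    fix v
    show "2 * deg v * (levels - d' v) + rest v (ptr' v)
      \<le> 2 * deg v * (levels - d v) + rest v (ptr v)"
      using assms(2)[of v] assms(3) by (cases "v = x") auto
  qed
  show "\<exists>v\<in>{1..n}. 2 * deg v * (levels - d' v) + rest v (ptr' v)
      < 2 * deg v * (levels - d v) + rest v (ptr v)"
    using assms(1,3) by blast
qed simp

lemma deg_pos: "x \<in> vt ` {1..M} \<Longrightarrow> 0 < deg x"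
  unfolding deg_def by (auto simp: card_gt_0_iff)

section \<open>The moves of the algorithm preserve the invariant\<close>

lemma active_init: "active (\<lambda>_. 0) (\<lambda>_. 0) (\<lambda>_. 0) (Suc 0) 0"
  unfolding active_def stable_def levels_def by auto

lemma active_bounds:
  assumes "active own d ptr i x"
  shows "d v \<le> levels" "ptr v \<le> M" "own a \<le> n" "d 0 = 0"
proof -
  note st = assms[unfolded active_def stable_def]
  show "d v \<le> levels" "d 0 = 0" using st by auto
  have "ptr v = 0 \<or> ptr v \<in> {1..M} \<and> vt (ptr v) = v" using st by blast
  then show "ptr v \<le> M" by auto
  show "own a \<le> n"
  proof (cases "own a = 0")
    case False
    then have "\<exists>c\<in>{1..M}. sl c = a \<and> vt c = own a" using st by simp
    then obtain c where "c \<in> {1..M}" "vt c = own a" by blast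
    then show ?thesis using vt_range[of c] by auto
  qed simp
qed

text \<open>Owners have positive labels, so a vertex that has not yet entered owns no slot.\<close>

lemma active_start:
  assumes "active own d ptr i 0" "0 < i" "i \<in> vt ` {1..M}"
  shows "active own d ptr (Suc i) i"
proof -
  have di: "d i = 0" using assms unfolding active_def by auto
  have st: "stable own d ptr" using assms(1) unfolding active_def by blast
  have "i \<notin> range own"
  proof
    assume "i \<in> range own"
    then obtain a where a: "own a = i" by auto
    with st assms(2) have "0 < d (own a)" unfolding stable_def by blast
    with di a show False by simp
  qed
  with di assms show ?thesis unfolding active_def levels_def by (auto simp: less_Suc_eq)
qed

lemma active_skip:
  assumes "active own d ptr i 0" "i \<notin> vt ` {1..M}"
  shows "active own d ptr (Suc i) 0"
  using assms unfolding active_def by (auto simp: less_Suc_eq)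

text \<open>With \<open>ptr x = 0\<close> the whole list has been scanned, so no neighbouring slot
  has an owner labelled below \<open>d x\<close>, and the raised label exceeds each of their labels
  by at most one. Labels of owners do not change, since \<open>x\<close> owns nothing.\<close>

lemma active_relabel:
  assumes act: "active own d ptr i x" and x: "x \<noteq> 0" "ptr x = 0" "0 < prev x (Suc M)"
  defines "d' \<equiv> d(x := Suc (d x))" and "ptr' \<equiv> ptr(x := prev x (Suc M))"
  shows "active own d' ptr' i (if d' x < levels then x else 0)" "work d' ptr' < work d ptr"
proof -
  note A = act[unfolded active_def]
  have xr: "x \<notin> range own" and dx: "d x < levels" and xi: "x < i" and xv: "x \<in> vt ` {1..M}"
    using A x by auto
  have own': "d' (own a) = d (own a)" for a using xr unfolding d'_def by auto
  have p: "prev x (Suc M) \<in> {1..M}" "vt (prev x (Suc M)) = x"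
    using prev_cases[of x "Suc M"] x(3) by auto
  have st: "stable own d ptr" using A by blast
  have "stable own d' ptr'"
    unfolding stable_def own'
  proof (intro conjI)
    show "d' 0 = 0" using st x unfolding stable_def d'_def by simp
    show "\<forall>v. d' v \<le> levels" using st dx unfolding stable_def d'_def by auto
    show "\<forall>a. own a \<noteq> 0 \<longrightarrow> (\<exists>c\<in>{1..M}. sl c = a \<and> vt c = own a) \<and> 0 < d (own a)"
      "\<forall>a. d (own a) < levels" "\<forall>a b. own a = own b \<longrightarrow> own a \<noteq> 0 \<longrightarrow> a = b"
      using st unfolding stable_def by blast+
    show "\<forall>c\<in>{1..M}. d' (vt c) \<le> Suc (d (own (sl c)))"
      using st x(2) unfolding stable_def d'_def by fastforce
    show "\<forall>c\<in>{1..M}. ptr' (vt c) < c \<longrightarrow> d' (vt c) \<le> d (own (sl c))"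
    proof (intro ballI impI)
      fix c assume c: "c \<in> {1..M}" "ptr' (vt c) < c"
      \<comment> \<open>The pointer now stands at the last cell of \<open>x\<close>, so no cell of
        \<open>x\<close> counts as scanned.\<close>
      have "vt c \<noteq> x"
      proof
        assume "vt c = x"
        with c prev_ge[of c "Suc M" x] show False unfolding ptr'_def by auto
      qed
      with c st show "d' (vt c) \<le> d (own (sl c))" unfolding stable_def d'_def ptr'_def by auto
    qed
    show "\<forall>v. ptr' v = 0 \<or> ptr' v \<in> {1..M} \<and> vt (ptr' v) = v"
      using st p unfolding stable_def ptr'_def by auto
  qed
  then show "active own d' ptr' i (if d' x < levels then x else 0)"
    unfolding active_def using A xi xv xr dx unfolding d'_def by auto
  have "2 * deg x * (levels - d x) = 2 * deg x * (levels - Suc (d x)) + 2 * deg x"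
    using dx by (metis Suc_diff_Suc mult_Suc_right add.commute)
  moreover have "rest x (prev x (Suc M)) \<le> deg x" using p by (intro rest_le) auto
  ultimately have "2 * deg x * (levels - d' x) + rest x (ptr' x)
      < 2 * deg x * (levels - d x) + rest x (ptr x)"
    using deg_pos[OF xv] unfolding d'_def ptr'_def by auto
  then show "work d' ptr' < work d ptr"
    using xv vt_range by (intro work_decreases[of x]) (auto simp: d'_def ptr'_def)
qed

text \<open>A refusal shows \<open>d x \<le> d (own a)\<close>, as required of a scanned cell. An
  acceptance gives the slot an owner with a larger label, so no slot loses value and all
  inequalities survive. The displaced owner proposes next; it is \<open>0\<close> if the slot was
  free.\<close>

lemma active_advance:
  assumes act: "active own d ptr i x" and x: "x \<noteq> 0" "ptr x \<noteq> 0"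
  defines "ptr' \<equiv> ptr(x := prev x (ptr x))" and "a \<equiv> sl (ptr x)"
  shows "\<not> d (own a) < d x \<Longrightarrow> active own d ptr' i x"
    and "d (own a) < d x \<Longrightarrow> active (own(a := x)) d ptr' i (own a)"
    and "work d ptr' < work d ptr"
proof -
  note A = act[unfolded active_def]
  have xr: "x \<notin> range own" and dx: "d x < levels" and xi: "x < i" and xv: "x \<in> vt ` {1..M}"
    using A x by auto
  have st: "stable own d ptr" using A by blast
  have "ptr x = 0 \<or> ptr x \<in> {1..M} \<and> vt (ptr x) = x" using st unfolding stable_def by blast
  then have p: "ptr x \<in> {1..M}" "vt (ptr x) = x" using x by auto
  have p': "prev x (ptr x) = 0 \<or> prev x (ptr x) \<in> {1..M} \<and> vt (prev x (ptr x)) = x"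
    using prev_cases[of x "ptr x"] p by auto
  \<comment> \<open>The pointer moves down by one list entry, so the old \<open>ptr x\<close> is the
    only cell that becomes scanned.\<close>
  have new: "ptr (vt c) < c \<or> c = ptr x" if "c \<in> {1..M}" "ptr' (vt c) < c" for c
  proof (cases "vt c = x")
    case True
    with that have "prev x (ptr x) < c" unfolding ptr'_def by simp
    with prev_ge[of c "ptr x" x] True that(1) have "\<not> c < ptr x" by auto
    with True show ?thesis by auto
  next
    case False
    with that show ?thesis unfolding ptr'_def by simp
  qed
  have ptr'_ok: "\<forall>v. ptr' v = 0 \<or> ptr' v \<in> {1..M} \<and> vt (ptr' v) = v"
    using st p' unfolding stable_def ptr'_def by auto
  show "work d ptr' < work d ptr"
    using xv vt_range rest_prev[OF x(2) p(2)]
    by (intro work_decreases[of x]) (auto simp: ptr'_def)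
  {
    assume na: "\<not> d (own a) < d x"
    have "d (vt c) \<le> d (own (sl c))" if "c \<in> {1..M}" "ptr' (vt c) < c" for c
      using new[OF that]
    proof
      assume "ptr (vt c) < c"
      then show ?thesis using st that unfolding stable_def by blast
    next
      assume "c = ptr x"
      then show ?thesis using p na by (simp add: a_def)
    qed
    with st ptr'_ok have "stable own d ptr'" unfolding stable_def by blast
    then show "active own d ptr' i x" using A unfolding active_def by blast
  }
  assume less: "d (own a) < d x"
  let ?own = "own(a := x)"
  have mono: "d (own b) \<le> d (?own b)" for b using less by auto
  have inj: "b = b'" if "?own b = ?own b'" "?own b \<noteq> 0" for b b'
  proof -
    have "own b \<noteq> x" "own b' \<noteq> x" using xr by auto
    with that have "b = a \<and> b' = a \<or> own b = own b' \<and> own b \<noteq> 0"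
      by (auto split: if_splits)
    then show ?thesis using st unfolding stable_def by blast
  qed
  have st': "stable ?own d ptr'"
    unfolding stable_def
  proof (intro conjI)
    show "d 0 = 0" "\<forall>v. d v \<le> levels" using st unfolding stable_def by auto
    show "\<forall>b. ?own b \<noteq> 0 \<longrightarrow> (\<exists>c\<in>{1..M}. sl c = b \<and> vt c = ?own b) \<and> 0 < d (?own b)"
    proof (intro allI impI)
      fix b assume "?own b \<noteq> 0"
      then show "(\<exists>c\<in>{1..M}. sl c = b \<and> vt c = ?own b) \<and> 0 < d (?own b)"
        using st less p unfolding stable_def by (cases "b = a") (auto simp: a_def)
    qed
    show "\<forall>b. d (?own b) < levels" using st dx unfolding stable_def by auto
    show "\<forall>b b'. ?own b = ?own b' \<longrightarrow> ?own b \<noteq> 0 \<longrightarrow> b = b'" using inj by blast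
    show "\<forall>c\<in>{1..M}. d (vt c) \<le> Suc (d (?own (sl c)))"
    proof
      fix c assume "c \<in> {1..M}"
      then have "d (vt c) \<le> Suc (d (own (sl c)))" using st unfolding stable_def by blast
      then show "d (vt c) \<le> Suc (d (?own (sl c)))" using mono[of "sl c"] by linarith
    qed
    show "\<forall>c\<in>{1..M}. ptr' (vt c) < c \<longrightarrow> d (vt c) \<le> d (?own (sl c))"
    proof (intro ballI impI)
      fix c assume c: "c \<in> {1..M}" "ptr' (vt c) < c"
      from new[OF this] show "d (vt c) \<le> d (?own (sl c))"
      proof
        assume "ptr (vt c) < c"
        then have "d (vt c) \<le> d (own (sl c))" using st c unfolding stable_def by blast
        then show ?thesis using mono[of "sl c"] by linarith
      next
        assume "c = ptr x"
        then show ?thesis using p by (simp add: a_def)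
      qed
    qed
    show "\<forall>v. ptr' v = 0 \<or> ptr' v \<in> {1..M} \<and> vt (ptr' v) = v"
      by (rule ptr'_ok)
  qed
  have y: "own a < i \<and> own a \<in> vt ` {1..M} \<and> own a \<notin> range ?own" if "own a \<noteq> 0"
  proof (intro conjI)
    show "own a \<in> vt ` {1..M}" using st that unfolding stable_def by (metis imageI)
    show "own a < i"
    proof (rule ccontr)
      assume "\<not> own a < i"
      with A have "d (own a) = 0" by auto
      moreover have "0 < d (own a)" using st that unfolding stable_def by blast
      ultimately show False by simp
    qed
    \<comment> \<open>An owner holds only one slot, so losing \<open>a\<close> leaves the displaced
      vertex unmatched.\<close>
    show "own a \<notin> range ?own"
    proof
      assume "own a \<in> range ?own"
      then obtain b where b: "own a = ?own b" by (rule rangeE)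
      have "b \<noteq> a" using b xr by (auto simp: image_iff)
      with b that st show False unfolding stable_def by auto
    qed
  qed
  have nr: "v \<notin> range own" if "v \<notin> range ?own" "v \<noteq> own a" for v
    using that by (auto simp: image_iff)
  have "d (own a) < levels" using st unfolding stable_def by blast
  with y have "own a \<noteq> 0 \<longrightarrow> own a < i \<and> own a \<in> vt ` {1..M} \<and> own a \<notin> range ?own \<and> d (own a) < levels"
    by blast
  moreover have "d v = levels"
    if "0 < v \<and> v < i \<and> v \<noteq> own a \<and> v \<notin> range ?own \<and> v \<in> vt ` {1..M}" for v
  proof -
    have "v \<noteq> x" using that by (auto simp: image_iff)
    with that nr[of v] A show ?thesis by blast
  qed
  moreover have "\<forall>v\<ge>i. d v = 0" using A by blast
  ultimately show "active ?own d ptr' i (own a)"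
    unfolding active_def using st' by blast
qed

text \<open>
  Some level below the top is the label of no owner. The slots above it and their owners,
  together with the vertices that gave up, form a set violating Hall's condition by exactly the
  number of unmatched vertices.
\<close>

lemma matching_optimal:
  assumes act: "active own d ptr (Suc n) 0"
    and g: "inj_on g T" "T \<subseteq> {1..n}" "\<And>v. v \<in> T \<Longrightarrow> \<exists>c\<in>{1..M}. vt c = v \<and> sl c = g v"
  shows "card T \<le> card (range own - {0})"
proof -
  note A = act[unfolded active_def]
  have st: "stable own d ptr" using A by blast
  define Slots where "Slots = {a. own a \<noteq> 0}"
  have R: "range own - {0} = own ` Slots" unfolding Slots_def by auto
  have injSlots: "inj_on own Slots" using st unfolding Slots_def inj_on_def stable_def by blast
  have Rn: "range own - {0} \<subseteq> {1..n}"
    using active_bounds(3)[OF act] by (auto simp: Suc_le_eq)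
  then have finR: "finite (range own - {0})" by (rule finite_subset) simp
  then have finSlots: "finite Slots" unfolding R using injSlots by (simp add: finite_image_iff)
  \<comment> \<open>At most \<open>n\<close> owners carry at most \<open>n\<close> labels, so one of
    the \<open>n + 1\<close> levels strictly between \<open>0\<close> and
    \<open>levels = n + 2\<close> is missed.\<close>
  have "\<exists>j\<in>{1..n+1}. j \<notin> d ` (range own - {0})"
  proof (rule ccontr)
    assume "\<not> ?thesis"
    then have "{1..n+1} \<subseteq> d ` (range own - {0})" by blast
    then have "n + 1 \<le> card (d ` (range own - {0}))"
      using card_mono[OF finite_imageI[OF finR]] by fastforce
    also have "\<dots> \<le> card (range own - {0})" using finR by (rule card_image_le)
    also have "\<dots> \<le> n" using card_mono[OF _ Rn] by simp
    finally show False by simp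
  qed
  then obtain j where j: "1 \<le> j" "j \<le> n + 1" "j \<notin> d ` (range own - {0})" by auto
  have gap: "d (own a) \<noteq> j" for a
  proof
    assume "d (own a) = j"
    moreover from this have "own a \<noteq> 0" using j st unfolding stable_def by (metis not_one_le_zero)
    ultimately show False using j(3) by auto
  qed
  define B where "B = {a. j < d (own a)}"
  have "d 0 = 0" using st unfolding stable_def by blast
  then have "own a \<noteq> 0" if "j < d (own a)" for a using that by (cases "own a = 0") auto
  then have BSlots: "B \<subseteq> Slots" unfolding B_def Slots_def by blast
  then have finB: "finite B" using finSlots finite_subset by blast
  define X where "X = own ` B \<union> (T - range own)"
  \<comment> \<open>A vertex of \<open>X\<close> has a label above \<open>j\<close>: it owns a slot
    of \<open>B\<close> or has given up. By stability the slot \<open>g v\<close> has value at least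
    \<open>j\<close>, and more than \<open>j\<close> because that level is missed. So
    \<open>g\<close> maps \<open>T \<inter> X\<close> into \<open>B\<close>.\<close>
  have gX: "g v \<in> B" if "v \<in> T" "v \<in> X" for v
  proof -
    from g(3)[OF that(1)] obtain c where c: "c \<in> {1..M}" "vt c = v" "sl c = g v" by blast
    have "d (vt c) \<le> Suc (d (own (sl c)))" using st c(1) unfolding stable_def by blast
    then have dv: "d v \<le> Suc (d (own (g v)))" unfolding c .
    have "j \<le> d (own (g v))"
    proof (cases "v \<in> own ` B")
      case True
      then have "j < d v" unfolding B_def by auto
      with dv show ?thesis by linarith
    next
      case False
      then have "v \<notin> range own" using that unfolding X_def by blast
      then have "d v = levels" using A c g(2) that(1) by (force simp: Suc_le_eq)
      with dv show ?thesis using j(2) unfolding levels_def by linarith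
    qed
    with gap[of "g v"] show ?thesis unfolding B_def by simp
  qed
  have finT: "finite T" using g(2) finite_subset by blast
  have "card (T \<inter> X) = card (g ` (T \<inter> X))"
    using g(1) by (intro card_image[symmetric]) (auto simp: inj_on_def)
  also have "\<dots> \<le> card B" using gX finB by (intro card_mono) auto
  also have "\<dots> = card (own ` B)"
    using inj_on_subset[OF injSlots BSlots] by (simp add: card_image)
  finally have 1: "card (T \<inter> X) \<le> card (own ` B)" .
  \<comment> \<open>A vertex of \<open>T\<close> outside \<open>X\<close> is matched, but not to a
    slot of \<open>B\<close>.\<close>
  have "card (T - X) \<le> card (range own - {0} - own ` B)"
    using finR g(2) unfolding X_def by (intro card_mono) auto
  also have "\<dots> = card (range own - {0}) - card (own ` B)"
    using finB BSlots R by (intro card_Diff_subset) auto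
  finally have "card (T - X) \<le> card (range own - {0}) - card (own ` B)" .
  moreover have "card (own ` B) \<le> card (range own - {0})"
    using finR BSlots R by (intro card_mono) auto
  moreover have "card T = card (T \<inter> X) + card (T - X)"
    using finT by (simp add: card_Int_Diff)
  ultimately show ?thesis using 1 by linarith
qed

end

section \<open>The matching program\<close>

definition build_body :: com where
  "build_body =
    (Seq (Assign ''v'' (Add (Read ''tail'' (Reg ''j'')) (Const 1)))
    (Seq (Assign ''w'' (Add (Read ''head'' (Reg ''j'')) (Const 1)))
    (Seq (Assign ''c'' (Add (Add (Reg ''j'') (Reg ''j'')) (Const 1)))
    (Seq (Write ''nxt'' (Reg ''c'') (Read ''fst'' (Reg ''v'')))
    (Seq (Write ''fst'' (Reg ''v'') (Reg ''c''))
    (Seq (Write ''slot'' (Reg ''c'') (Reg ''w''))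
    (Seq (Assign ''c'' (Add (Reg ''c'') (Const 1)))
    (Seq (Write ''nxt'' (Reg ''c'') (Read ''fst'' (Reg ''w'')))
    (Seq (Write ''fst'' (Reg ''w'') (Reg ''c''))
    (Seq (Write ''slot'' (Reg ''c'') (Add (Reg ''n'') (Reg ''v'')))
         (Assign ''j'' (Add (Reg ''j'') (Const 1)))))))))))))"

definition build_prog :: com where
  "build_prog =
    Seq (Assign ''j'' (Const 0)) (While (Less (Reg ''j'') (Reg ''m'')) build_body)"

text \<open>One pass makes a single move. Since a free slot is owned by \<open>0\<close> and the
  label of \<open>0\<close> is \<open>0\<close>, free and occupied slots are tested by the same
  comparison.\<close>

definition propose_prog :: com where
  "propose_prog =
    Seq (Assign ''c'' (Read ''ptr'' (Reg ''x'')))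
    (Cond (Equal (Reg ''c'') (Const 0))
      (Seq (Write ''lab'' (Reg ''x'') (Add (Read ''lab'' (Reg ''x'')) (Const 1)))
      (Seq (Write ''ptr'' (Reg ''x'') (Read ''fst'' (Reg ''x'')))
           (Cond (Less (Read ''lab'' (Reg ''x'')) (Add (Reg ''n'') (Const 2)))
             Skip (Assign ''x'' (Const 0)))))
      (Seq (Write ''ptr'' (Reg ''x'') (Read ''nxt'' (Reg ''c'')))
      (Seq (Assign ''c'' (Read ''slot'' (Reg ''c'')))
           (Cond (Less (Read ''lab'' (Read ''own'' (Reg ''c''))) (Read ''lab'' (Reg ''x'')))
             (Seq (Assign ''w'' (Read ''own'' (Reg ''c'')))
             (Seq (Write ''own'' (Reg ''c'') (Reg ''x''))
                  (Assign ''x'' (Reg ''w''))))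
             Skip))))"

text \<open>A vertex without cells would climb through all levels without using up any potential, so
  it is skipped.\<close>

definition match_body :: com where
  "match_body =
    Seq (Cond (Equal (Read ''fst'' (Reg ''i'')) (Const 0))
           (Assign ''x'' (Const 0)) (Assign ''x'' (Reg ''i'')))
    (Seq (While (Less (Const 0) (Reg ''x'')) propose_prog)
         (Assign ''i'' (Add (Reg ''i'') (Const 1))))"

definition match_prog :: com where
  "match_prog =
    Seq (Assign ''i'' (Const 1))
        (While (Less (Reg ''i'') (Add (Reg ''n'') (Const 1))) match_body)"

text \<open>
  Vertices are shifted by one. The slot \<open>w\<close> stands for the arc into \<open>w\<close>, the slot \<open>n + w\<close> for the
  arc out of \<open>w\<close>, and the \<open>j\<close>-th arc occupies the cell \<open>2 j + 1\<close> of its tail and the cell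
  \<open>2 j + 2\<close> of its head.
\<close>

definition cell_vertex :: "(nat \<times> nat) list \<Rightarrow> nat \<Rightarrow> nat" where
  "cell_vertex es c = Suc ((if odd c then fst else snd) (es ! ((c - 1) div 2)))"

definition cell_slot :: "nat \<Rightarrow> (nat \<times> nat) list \<Rightarrow> nat \<Rightarrow> nat" where
  "cell_slot n es c =
    (if odd c then Suc (snd (es ! ((c - 1) div 2))) else n + Suc (fst (es ! ((c - 1) div 2))))"

text \<open>The word bound covers slot numbers up to \<open>2 * n\<close>, cell numbers up to
  \<open>2 * m\<close>, labels up to \<open>n + 2\<close> and output positions up to
  \<open>3 * n + 3\<close>.\<close>

locale arc_input =
  fixes n :: nat and es :: "(nat \<times> nat) list" and W :: nat
  assumes arc_range: "j < length es \<Longrightarrow> fst (es ! j) < n \<and> snd (es ! j) < n"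
    and word_bound: "4 * n + 4 * length es + 8 \<le> W"
begin

abbreviation m :: nat where "m \<equiv> length es"

sublocale slot_graph n "2 * m" "cell_vertex es" "cell_slot n es"
proof
  fix c assume c: "c \<in> {1..2 * m}"
  then have "(c - 1) div 2 < m" by auto
  from arc_range[OF this] show "cell_vertex es c \<in> {1..n}"
    by (auto simp: cell_vertex_def)
qed

lemma cell_slot_range: "c \<in> {1..2 * m} \<Longrightarrow> cell_slot n es c \<in> {1..2 * n}"
proof -
  assume c: "c \<in> {1..2 * m}"
  then have "(c - 1) div 2 < m" by auto
  from arc_range[OF this] show ?thesis
    by (auto simp: cell_slot_def)
qed

lemma cell_simps [simp]:
  "cell_vertex es (Suc (2 * j)) = Suc (fst (es ! j))"
  "cell_slot n es (Suc (2 * j)) = Suc (snd (es ! j))"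
  "cell_vertex es (Suc (Suc (2 * j))) = Suc (snd (es ! j))"
  "cell_slot n es (Suc (Suc (2 * j))) = n + Suc (fst (es ! j))"
  by (auto simp: cell_vertex_def cell_slot_def)

lemma first_cell: "0 < prev v (Suc (2 * m)) \<longleftrightarrow> v \<in> cell_vertex es ` {1..2 * m}"
proof
  assume "0 < prev v (Suc (2 * m))"
  with prev_cases[of v "Suc (2 * m)"]
  have "prev v (Suc (2 * m)) \<in> {1..2 * m}" "cell_vertex es (prev v (Suc (2 * m))) = v" by auto
  then show "v \<in> cell_vertex es ` {1..2 * m}" by (metis imageI)
next
  assume "v \<in> cell_vertex es ` {1..2 * m}"
  then obtain c where "c \<in> {1..2 * m}" "cell_vertex es c = v" by blast
  with prev_ge[of c "Suc (2 * m)" v] show "0 < prev v (Suc (2 * m))" by auto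
qed

section \<open>Verification of the matching phase\<close>

definition zero_arrays :: "store \<Rightarrow> bool" where
  "zero_arrays s \<longleftrightarrow> (\<forall>i. arr s ''pr'' i = 0 \<and> arr s ''su'' i = 0 \<and> arr s ''fo'' i = 0 \<and>
     arr s ''start'' i = 0)"

definition match_arrays_zero :: "store \<Rightarrow> bool" where
  "match_arrays_zero s \<longleftrightarrow>
     arr s ''own'' = (\<lambda>_. 0) \<and> arr s ''lab'' = (\<lambda>_. 0) \<and> arr s ''ptr'' = (\<lambda>_. 0)"

definition cells_upto :: "nat \<Rightarrow> store \<Rightarrow> bool" where
  "cells_upto k s \<longleftrightarrow> reg s ''n'' = n \<and>
     (\<forall>v. arr s ''fst'' v = prev v (Suc k)) \<and>
     (\<forall>c\<in>{1..k}. arr s ''nxt'' c = prev (cell_vertex es c) c \<and>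
        arr s ''slot'' c = cell_slot n es c)"

text \<open>An iteration takes 11 steps and a loop test, hence \<open>12 * m\<close>.
  \<open>R\<close> is the budget handed on to the continuation.\<close>

lemma build_prog_correct:
  assumes s: "s = input_store n es" and T: "12 * m + 2 + R \<le> T"
    and Q: "\<And>s T. cells_upto (2 * m) s \<Longrightarrow> zero_arrays s \<Longrightarrow> match_arrays_zero s \<Longrightarrow>
      R \<le> T \<Longrightarrow> Q s T"
  shows "wp W build_prog Q s T"
proof -
  define I where "I = (\<lambda>s T. cells_upto (2 * reg s ''j'') s \<and> reg s ''m'' = m \<and>
    reg s ''j'' \<le> m \<and> zero_arrays s \<and> match_arrays_zero s \<and>
    (\<forall>j<m. arr s ''tail'' j = fst (es ! j) \<and> arr s ''head'' j = snd (es ! j)) \<and>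
    12 * (m - reg s ''j'') + 1 + R \<le> T)"
  show ?thesis
    unfolding build_prog_def wp_Seq
  proof (subst wp_Assign, intro conjI)
    show "aval (Const 0) s < W" "1 \<le> T" using word_bound T by auto
    show "wp W (While (Less (Reg ''j'') (Reg ''m'')) build_body)
      Q (s\<lparr>reg := (reg s)(''j'' := aval (Const 0) s)\<rparr>) (T - 1)"
    proof (rule wp_While[where I = I])
      show "I (s\<lparr>reg := (reg s)(''j'' := aval (Const 0) s)\<rparr>) (T - 1)"
        using T by (simp add: I_def s input_store_def cells_upto_def zero_arrays_def
          match_arrays_zero_def prev_0) arith
    next
      fix s T assume "I s T" then show "1 \<le> T" by (auto simp: I_def)
    next
      fix s T assume "I s T" "\<not> bval (Less (Reg ''j'') (Reg ''m'')) s"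
      then show "Q s (T - 1)" by (intro Q) (auto simp: I_def)
    next
      fix s T assume I: "I s T" and b: "bval (Less (Reg ''j'') (Reg ''m'')) s"
      define j where "j = reg s ''j''"
      have j: "j < m" using I b by (auto simp: I_def j_def)
      note th = I[unfolded I_def cells_upto_def, folded j_def]
      have ar: "fst (es ! j) < n" "snd (es ! j) < n" using arc_range[OF j] by auto
      have ht: "arr s ''tail'' j = fst (es ! j)" "arr s ''head'' j = snd (es ! j)"
        using th j by auto
      have pb: "prev v (Suc (2 * j)) \<le> 2 * m" for v
        using prev_cases[of v "Suc (2 * j)"] j by linarith
      have p1: "prev v (Suc (Suc (2 * j))) =
          (if v = Suc (fst (es ! j)) then Suc (2 * j) else prev v (Suc (2 * j)))" for v
        using prev_Suc[of "Suc (2 * j)" v] by auto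
      have p2: "prev v (Suc (Suc (Suc (2 * j)))) =
          (if v = Suc (snd (es ! j)) then Suc (Suc (2 * j)) else prev v (Suc (Suc (2 * j))))" for v
        using prev_Suc[of "Suc (Suc (2 * j))" v] by auto
      have split: "c \<le> Suc (Suc (2 * j)) \<longleftrightarrow> c \<le> 2 * j \<or> c = Suc (2 * j) \<or> c = Suc (Suc (2 * j))"
        for c by auto
      show "wp W build_body I s (T - 1)"
        unfolding build_body_def
        using th j ar word_bound pb[of "Suc (fst (es ! j))"] pb[of "Suc (snd (es ! j))"]
        by (simp add: I_def cells_upto_def zero_arrays_def match_arrays_zero_def
            j_def[symmetric] ht p1 p2 split mult_2[symmetric])
          (auto simp: p1 p2 split less_Suc_eq)
    qed
  qed
qed

definition matching :: "store \<Rightarrow> nat \<Rightarrow> nat \<Rightarrow> bool" where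
  "matching s i x \<longleftrightarrow> cells_upto (2 * m) s \<and> zero_arrays s \<and>
     active (arr s ''own'') (arr s ''lab'') (arr s ''ptr'') i x"

abbreviation work_left :: "store \<Rightarrow> nat" where
  "work_left s \<equiv> work (arr s ''lab'') (arr s ''ptr'')"

text \<open>A move takes at most 8 steps and lowers the potential by at least one. With the loop
  test this makes 9 credits per unit of potential; the \<open>1\<close> in the postcondition is the
  credit for the next test.\<close>

lemma propose_prog_correct:
  assumes inv: "matching s i (reg s ''x'')" "reg s ''i'' = i0" "i \<le> Suc n" "0 < reg s ''x''"
    and T: "9 * work_left s + R \<le> T"
  shows "wp W propose_prog (\<lambda>s T. matching s i (reg s ''x'') \<and> reg s ''i'' = i0 \<and>
    9 * work_left s + 1 + R \<le> T) s T"
proof -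
  define x own lab ptr where
    "x = reg s ''x''" and "own = arr s ''own''" and "lab = arr s ''lab''" and "ptr = arr s ''ptr''"
  note folds = x_def[symmetric] own_def[symmetric] lab_def[symmetric] ptr_def[symmetric]
  have act: "active own lab ptr i x" and cells: "cells_upto (2 * m) s" and zero: "zero_arrays s"
    using inv unfolding matching_def folds by auto
  have x: "x \<noteq> 0" "x < i" "x \<in> cell_vertex es ` {1..2 * m}" "lab x < levels"
    using inv(4) act unfolding active_def folds by auto
  note bounds = active_bounds[OF act]
  have fx: "arr s ''fst'' x = prev x (Suc (2 * m))" "0 < prev x (Suc (2 * m))"
    "prev x (Suc (2 * m)) \<le> 2 * m"
    using cells x(3) first_cell prev_cases[of x "Suc (2 * m)"] unfolding cells_upto_def by auto
  have n: "reg s ''n'' = n" using cells unfolding cells_upto_def by auto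
  have W: "x < W" "Suc (lab x) < W" "own v < W" "ptr v < W" "prev x (Suc (2 * m)) < W" for v
    using x bounds(2)[of v] bounds(3)[of v] fx word_bound inv(3) unfolding levels_def by auto
  have cells': "cells_upto (2 * m) s' \<and> zero_arrays s'"
    if "reg s' ''n'' = n" and
      "\<forall>b\<in>{''fst'', ''nxt'', ''slot'', ''pr'', ''su'', ''fo'', ''start''}. arr s' b = arr s b" for s'
    using that cells zero unfolding cells_upto_def zero_arrays_def by simp
  show ?thesis
  proof (cases "ptr x = 0")
    case True
    note rel = active_relabel[OF act x(1) True fx(2)]
    have "9 * work (lab(x := Suc (lab x))) (ptr(x := prev x (Suc (2 * m)))) + 9 + R \<le> T"
      using rel(2) T unfolding folds by linarith
    then obtain T0 where T0: "T = T0 + 9" "9 * work (lab(x := Suc (lab x))) (ptr(x := prev x (Suc (2 * m)))) + R \<le> T0"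
      by (intro that[of "T - 9"]) auto
    then show ?thesis
      using True W x(4) rel(1) fx(1) cells'
      unfolding propose_prog_def matching_def levels_def
      by (auto simp: folds T0(1) n inv(2) split: if_splits)
  next
    case False
    have st: "stable own lab ptr" using act unfolding active_def by blast
    then have "ptr x = 0 \<or> ptr x \<in> {1..2 * m} \<and> cell_vertex es (ptr x) = x"
      unfolding stable_def by blast
    with False have p: "ptr x \<in> {1..2 * m}" "cell_vertex es (ptr x) = x" by auto
    have c: "arr s ''nxt'' (ptr x) = prev x (ptr x)" "arr s ''slot'' (ptr x) = cell_slot n es (ptr x)"
      using cells p unfolding cells_upto_def by auto
    have W': "cell_slot n es (ptr x) < W" "prev x (ptr x) < W"
      using cell_slot_range[OF p(1)] word_bound prev_cases[of x "ptr x"] p(1) by auto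
    note adv = active_advance[OF act x(1) False]
    have "9 * work lab (ptr(x := prev x (ptr x))) + 9 + R \<le> T"
      using adv(3) T unfolding folds by linarith
    then obtain T0 where T0: "T = T0 + 9" "9 * work lab (ptr(x := prev x (ptr x))) + R \<le> T0"
      by (intro that[of "T - 9"]) auto
    then show ?thesis
      using False W W' adv(1,2) c cells'
      unfolding propose_prog_def matching_def
      by (auto simp: folds T0(1) n inv(2))
  qed
qed

text \<open>With \<open>2 * m\<close> cells the initial potential is
  \<open>2 * (2 * m) * levels\<close>, at 9 credits a unit; each vertex adds a constant. This is the
  only phase that is not linear in \<open>n + m\<close>.\<close>

lemma match_prog_correct:
  assumes s: "cells_upto (2 * m) s" "zero_arrays s" "match_arrays_zero s"
    and T: "18 * (2 * m * levels) + 6 * n + 2 + R \<le> T"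
    and Q: "\<And>s T. matching s (Suc n) 0 \<Longrightarrow> R \<le> T \<Longrightarrow> Q s T"
  shows "wp W match_prog Q s T"
proof -
  define I where "I = (\<lambda>s T. matching s (reg s ''i'') 0 \<and> 0 < reg s ''i'' \<and> reg s ''i'' \<le> Suc n \<and>
    9 * work_left s + 6 * (Suc n - reg s ''i'') + 1 + R \<le> T)"
  have "wp W (While (Less (Reg ''i'') (Add (Reg ''n'') (Const 1))) match_body) Q
    (s\<lparr>reg := (reg s)(''i'' := 1)\<rparr>) (T - 1)"
  proof (rule wp_While[where I = I])
    show "I (s\<lparr>reg := (reg s)(''i'' := 1)\<rparr>) (T - 1)"
      using s T active_init work_init
      by (simp add: I_def matching_def match_arrays_zero_def cells_upto_def zero_arrays_def) arith
  next
    fix s T assume "I s T" then show "1 \<le> T" by (auto simp: I_def)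
  next
    fix s T assume "I s T" "\<not> bval (Less (Reg ''i'') (Add (Reg ''n'') (Const 1))) s"
    then have "reg s ''i'' = Suc n" "matching s (reg s ''i'') 0" "R \<le> T - 1"
      by (auto simp: I_def matching_def cells_upto_def)
    then show "Q s (T - 1)" by (intro Q) auto
  next
    fix s T assume I: "I s T" and b: "bval (Less (Reg ''i'') (Add (Reg ''n'') (Const 1))) s"
    define i where "i = reg s ''i''"
    have mat: "matching s i 0" and i: "0 < i" "i \<le> n"
      and T: "9 * work_left s + 6 * (Suc n - i) + 1 + R \<le> T"
      using I b by (auto simp: I_def i_def matching_def cells_upto_def)
    define x where "x = (if arr s ''fst'' i = 0 then 0 else i)"
    have act: "active (arr s ''own'') (arr s ''lab'') (arr s ''ptr'') i 0"
      and fi: "arr s ''fst'' i = prev i (Suc (2 * m))"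
      using mat unfolding matching_def cells_upto_def by auto
    have mat': "matching (s\<lparr>reg := (reg s)(''x'' := x)\<rparr>) (Suc i) x"
    proof (cases "i \<in> cell_vertex es ` {1..2 * m}")
      case True
      with fi first_cell[of i] have "x = i" unfolding x_def by simp
      with mat active_start[OF act i(1) True] show ?thesis
        unfolding matching_def cells_upto_def zero_arrays_def by simp
    next
      case False
      with fi first_cell[of i] have "x = 0" unfolding x_def by simp
      with mat active_skip[OF act False] show ?thesis
        unfolding matching_def cells_upto_def zero_arrays_def by simp
    qed
    \<comment> \<open>Set aside for the increment of \<open>i\<close> and for the remaining outer
      iterations.\<close>
    let ?R = "3 + 6 * (Suc n - Suc i) + R"
    define J where "J = (\<lambda>s T. matching s (Suc i) (reg s ''x'') \<and> reg s ''i'' = i \<and>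
      9 * work_left s + 1 + ?R \<le> T)"
    have loop: "wp W (While (Less (Const 0) (Reg ''x'')) propose_prog)
      (wp W (Assign ''i'' (Add (Reg ''i'') (Const 1))) I) (s\<lparr>reg := (reg s)(''x'' := x)\<rparr>) (T - 3)"
    proof (rule wp_While[where I = J])
      show "J (s\<lparr>reg := (reg s)(''x'' := x)\<rparr>) (T - 3)"
        using mat' T i by (auto simp: J_def i_def[symmetric] Suc_diff_le)
    next
      fix s T assume "J s T" then show "1 \<le> T" by (auto simp: J_def)
    next
      fix s T assume J: "J s T" and b: "bval (Less (Const 0) (Reg ''x'')) s"
      show "wp W propose_prog J s (T - 1)"
        unfolding J_def
        by (rule propose_prog_correct) (use J b i in \<open>auto simp: J_def\<close>)
    next
      fix s T assume J: "J s T" and b: "\<not> bval (Less (Const 0) (Reg ''x'')) s"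
      then show "wp W (Assign ''i'' (Add (Reg ''i'') (Const 1))) I s (T - 1)"
        using i word_bound
        by (auto simp: J_def I_def matching_def cells_upto_def zero_arrays_def)
    qed
    have "aval (Reg ''i'') s < W" "4 \<le> T" using i T word_bound by (auto simp: i_def)
    moreover from this obtain T0 where "T = T0 + 4" by (metis le_add_diff_inverse2)
    ultimately show "wp W match_body I s (T - 1)"
      using loop unfolding match_body_def
      by (cases "arr s ''fst'' i = 0") (simp_all add: x_def i_def[symmetric] numeral_3_eq_3)
  qed
  with T word_bound show ?thesis unfolding match_prog_def by simp
qed

end

section \<open>From the matching to short paths\<close>

text \<open>The owner of the in-slot of \<open>i\<close> becomes the predecessor of
  \<open>i\<close>. The owner of the out-slot only records \<open>i\<close> in \<open>fo\<close> as
  a possible predecessor of its own, since the arcs of both kinds together may conflict.\<close>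

definition orient_body :: com where
  "orient_body =
    Seq (Assign ''u'' (Read ''own'' (Reg ''i'')))
    (Seq (Write ''pr'' (Reg ''i'') (Reg ''u''))
    (Seq (Write ''su'' (Reg ''u'') (Reg ''i''))
    (Seq (Assign ''u'' (Read ''own'' (Add (Reg ''n'') (Reg ''i''))))
    (Seq (Write ''fo'' (Reg ''u'') (Reg ''i''))
         (Assign ''i'' (Add (Reg ''i'') (Const 1)))))))"

text \<open>Free slots are owned by \<open>0\<close>, so the cells \<open>su[0]\<close> and \<open>fo[0]\<close> hold junk after the loop.\<close>

definition orient_prog :: com where
  "orient_prog =
    Seq (Assign ''i'' (Const 1))
    (Seq (While (Less (Reg ''i'') (Add (Reg ''n'') (Const 1))) orient_body)
    (Seq (Write ''su'' (Const 0) (Const 0)) (Write ''fo'' (Const 0) (Const 0))))"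

text \<open>If \<open>w\<close> has no successor then \<open>y = 0\<close>: the write to cell
  \<open>0\<close> of \<open>pr\<close> stores the \<open>0\<close> already there, and the zero in
  cell \<open>0\<close> of \<open>fo\<close> ends the loop.\<close>

definition repair_step :: com where
  "repair_step =
    Seq (Assign ''w'' (Read ''fo'' (Reg ''x'')))
    (Seq (Assign ''y'' (Read ''su'' (Reg ''w'')))
    (Seq (Write ''su'' (Reg ''w'') (Reg ''x''))
    (Seq (Write ''pr'' (Reg ''x'') (Reg ''w''))
    (Seq (Write ''pr'' (Reg ''y'') (Const 0))
         (Assign ''x'' (Reg ''y''))))))"

definition repair_cond :: bexp where
  "repair_cond = Conj (Neg (Equal (Read ''fo'' (Reg ''x'')) (Const 0)))
    (Equal (Read ''pr'' (Reg ''x'')) (Const 0))"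

definition repair_body :: com where
  "repair_body =
    Seq (Assign ''x'' (Reg ''i''))
    (Seq (While repair_cond repair_step)
         (Assign ''i'' (Add (Reg ''i'') (Const 1))))"

definition repair_prog :: com where
  "repair_prog =
    Seq (Assign ''i'' (Const 1))
        (While (Less (Reg ''i'') (Add (Reg ''n'') (Const 1))) repair_body)"

text \<open>If \<open>i\<close> has no successor then \<open>w = 0\<close>, and the zero in cell
  \<open>0\<close> of \<open>su\<close> makes the test fail.\<close>

definition cut_body :: com where
  "cut_body =
    Seq (Assign ''w'' (Read ''su'' (Reg ''i'')))
    (Seq (Cond (Conj (Neg (Equal (Read ''pr'' (Reg ''i'')) (Const 0)))
                     (Neg (Equal (Read ''su'' (Reg ''w'')) (Const 0))))
            (Seq (Write ''su'' (Reg ''i'') (Const 0)) (Write ''pr'' (Reg ''w'') (Const 0)))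
            Skip)
         (Assign ''i'' (Add (Reg ''i'') (Const 1))))"

definition cut_prog :: com where
  "cut_prog =
    Seq (Assign ''i'' (Const 1))
        (While (Less (Reg ''i'') (Add (Reg ''n'') (Const 1))) cut_body)"

section \<open>Exchange and cutting on successor functions\<close>

context arc_input
begin

text \<open>The arcs on shifted vertices. Truncated subtraction would confuse \<open>0\<close> with
  vertex \<open>1\<close>, so \<open>0\<close> is excluded explicitly.\<close>

definition arc :: "nat \<Rightarrow> nat \<Rightarrow> bool" where
  "arc v w \<longleftrightarrow> v \<noteq> 0 \<and> w \<noteq> 0 \<and> (v - 1, w - 1) \<in> set es"

lemma arc_le: "arc v w \<Longrightarrow> 0 < v \<and> v \<le> n \<and> 0 < w \<and> w \<le> n"
proof -
  assume a: "arc v w"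
  then obtain j where j: "j < m" "es ! j = (v - 1, w - 1)"
    unfolding arc_def by (auto simp: in_set_conv_nth)
  from arc_range[OF j(1)] j(2) a show ?thesis unfolding arc_def by auto
qed

lemma cell_arc:
  assumes "c \<in> {1..2 * m}"
  shows "\<exists>w\<in>{1..n}. cell_slot n es c = w \<and> arc (cell_vertex es c) w \<or>
    cell_slot n es c = n + w \<and> arc w (cell_vertex es c)"
proof -
  define j where "j = (c - 1) div 2"
  have j: "j < m" using assms by (auto simp: j_def)
  have j': "(c - Suc 0) div 2 = j" by (simp add: j_def)
  have e: "(fst (es ! j), snd (es ! j)) \<in> set es" using j by simp
  show ?thesis
  proof (cases "odd c")
    case True
    then show ?thesis using arc_range[OF j] e
      by (intro bexI[of _ "Suc (snd (es ! j))"])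
        (auto simp: cell_slot_def cell_vertex_def arc_def j')
  next
    case False
    then show ?thesis using arc_range[OF j] e
      by (intro bexI[of _ "Suc (fst (es ! j))"])
        (auto simp: cell_slot_def cell_vertex_def arc_def j')
  qed
qed

text \<open>A matching between tails and heads of arcs, stored in both directions with
  \<open>0\<close> for undefined. As a subgraph it is a disjoint union of paths and cycles.\<close>

definition linked :: "(nat \<Rightarrow> nat) \<Rightarrow> (nat \<Rightarrow> nat) \<Rightarrow> bool" where
  "linked su pr \<longleftrightarrow> su 0 = 0 \<and> pr 0 = 0 \<and>
     (\<forall>v w. v \<noteq> 0 \<longrightarrow> w \<noteq> 0 \<longrightarrow> su v = w \<longleftrightarrow> pr w = v) \<and>
     (\<forall>v. su v \<noteq> 0 \<longrightarrow> arc v (su v))"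

lemma linked_le: "linked su pr \<Longrightarrow> su v \<le> n \<and> pr v \<le> n"
  unfolding linked_def by (metis arc_le le0)

text \<open>\<open>fo\<close> is a second such matching, stored at the heads. Every vertex of
  \<open>S\<close> is a tail of the first matching or a head of the second; the exchange has to
  supply the latter with predecessors.\<close>

definition backup :: "(nat \<Rightarrow> nat) \<Rightarrow> (nat \<Rightarrow> nat) \<Rightarrow> nat set \<Rightarrow> bool" where
  "backup su fo S \<longleftrightarrow> fo 0 = 0 \<and> (\<forall>v. fo v \<noteq> 0 \<longrightarrow> arc (fo v) v) \<and>
     (\<forall>v w. fo v = fo w \<longrightarrow> fo v \<noteq> 0 \<longrightarrow> v = w) \<and> (\<forall>v\<in>S. su v \<noteq> 0 \<or> fo v \<noteq> 0)"

text \<open>A slot determines its owner, which makes \<open>fo\<close> injective and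
  \<open>pr\<close> inverse to \<open>su\<close>. Each owner holds an in-slot, giving it a
  successor, or an out-slot, giving it a backup predecessor.\<close>

lemma orient_result:
  assumes act: "active own d ptr (Suc n) 0"
    and pr: "\<And>w. pr w = (if 0 < w \<and> w \<le> n then own w else 0)"
    and su: "\<And>u w. u \<noteq> 0 \<Longrightarrow> w \<noteq> 0 \<Longrightarrow> su u = w \<longleftrightarrow> w \<le> n \<and> own w = u"
    and fo: "\<And>u w. u \<noteq> 0 \<Longrightarrow> w \<noteq> 0 \<Longrightarrow> fo u = w \<longleftrightarrow> w \<le> n \<and> own (n + w) = u"
    and z: "su 0 = 0" "fo 0 = 0"
  shows "linked su pr" "backup su fo (range own - {0})"
proof -
  have st: "stable own d ptr" using act unfolding active_def by blast
  have own: "\<exists>w\<in>{1..n}. a = w \<and> arc (own a) w \<or> a = n + w \<and> arc w (own a)" if "own a \<noteq> 0" for a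
  proof -
    have "\<exists>c\<in>{1..2 * m}. cell_slot n es c = a \<and> cell_vertex es c = own a"
      using st that unfolding stable_def by blast
    then show ?thesis using cell_arc by metis
  qed
  have in_arc: "arc (own w) w" if "own w \<noteq> 0" "w \<le> n" for w
    using own[OF that(1)] that(2) by auto
  have out_arc: "arc w (own (n + w))" if "own (n + w) \<noteq> 0" "w \<noteq> 0" for w
    using own[OF that(1)] that(2) by auto
  have s: "su u \<le> n \<and> own (su u) = u" if "su u \<noteq> 0" for u
    using su[of u "su u"] that z by (cases "u = 0") auto
  have f: "fo u \<le> n \<and> own (n + fo u) = u" if "fo u \<noteq> 0" for u
    using fo[of u "fo u"] that z by (cases "u = 0") auto
  show "linked su pr"
    unfolding linked_def
  proof (intro conjI allI impI)
    fix v assume v: "su v \<noteq> 0"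
    with z have "v \<noteq> 0" by metis
    with in_arc[of "su v"] s[OF v] show "arc v (su v)" by auto
  next
    fix v w :: nat assume "v \<noteq> 0" "w \<noteq> 0"
    then show "su v = w \<longleftrightarrow> pr w = v" using su[of v w] by (auto simp: pr)
  qed (use z pr in auto)
  show "backup su fo (range own - {0})"
    unfolding backup_def
  proof (intro conjI allI impI ballI)
    fix v assume v: "fo v \<noteq> 0"
    with z have "v \<noteq> 0" by metis
    with out_arc[of "fo v"] f[OF v] v show "arc (fo v) v" by auto
  next
    fix v w assume "fo v = fo w" "fo v \<noteq> 0"
    then show "v = w" using f by metis
  next
    fix v assume "v \<in> range own - {0}"
    then obtain a where a: "v = own a" "own a \<noteq> 0" by auto
    from own[OF a(2)] show "su v \<noteq> 0 \<or> fo v \<noteq> 0"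
      using su[of v a] fo[of v "a - n"] a by auto
  qed (rule z)
qed

text \<open>\<open>x\<close> is the end of the current alternating walk, the only vertex below
  \<open>i\<close> that may have a backup but no predecessor; \<open>x = 0\<close> between
  walks.\<close>

definition repairing :: "(nat \<Rightarrow> nat) \<Rightarrow> (nat \<Rightarrow> nat) \<Rightarrow> (nat \<Rightarrow> nat) \<Rightarrow> nat set \<Rightarrow> nat \<Rightarrow> nat \<Rightarrow> bool"
  where "repairing su pr fo S i x \<longleftrightarrow> linked su pr \<and> backup su fo S \<and> x \<le> n \<and>
    (\<forall>v<i. v \<noteq> x \<longrightarrow> fo v \<noteq> 0 \<longrightarrow> pr v \<noteq> 0)"

text \<open>The number of backup arcs not in use. It drops with each exchange, so all walks together
  make at most \<open>n\<close> exchanges.\<close>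

definition unsettled :: "(nat \<Rightarrow> nat) \<Rightarrow> (nat \<Rightarrow> nat) \<Rightarrow> nat" where
  "unsettled su fo = card {v \<in> {1..n}. fo v \<noteq> 0 \<and> su (fo v) \<noteq> v}"

lemma unsettled_le: "unsettled su fo \<le> n"
proof -
  have "unsettled su fo \<le> card {1..n}" unfolding unsettled_def by (rule card_mono) auto
  then show ?thesis by simp
qed

text \<open>
  This is the exchange of the Mendelsohn--Dulmage theorem: no vertex loses its successor, and the
  backup arc into \<open>x\<close> is never displaced again.
\<close>

lemma repairing_step:
  assumes inv: "repairing su pr fo S i x" and x: "fo x \<noteq> 0" "pr x = 0"
  defines "w \<equiv> fo x" and "y \<equiv> su (fo x)"
  shows "repairing (su(w := x)) (pr(x := w, y := 0)) fo S i y"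
    and "unsettled (su(w := x)) fo < unsettled su fo"
proof -
  have L: "linked su pr" and B: "backup su fo S"
    and settled: "\<And>v. v < i \<Longrightarrow> v \<noteq> x \<Longrightarrow> fo v \<noteq> 0 \<Longrightarrow> pr v \<noteq> 0"
    using inv unfolding repairing_def by auto
  have wx: "arc w x" using B x unfolding backup_def w_def by blast
  then have ne: "w \<noteq> 0" "x \<noteq> 0" unfolding arc_def by auto
  have su_pr: "su v = u \<longleftrightarrow> pr u = v" if "v \<noteq> 0" "u \<noteq> 0" for u v
    using L that unfolding linked_def by blast
  have L0: "su 0 = 0" "pr 0 = 0" using L unfolding linked_def by auto
  have yw: "y \<noteq> 0 \<Longrightarrow> pr y = w" using su_pr[of w y] ne unfolding y_def w_def by auto
  \<comment> \<open>Since \<open>pr x = 0\<close>, the vertex \<open>w\<close> does not yet point to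
    \<open>x\<close>.\<close>
  have yx: "y \<noteq> x" using su_pr[of w x] ne x unfolding y_def w_def by auto
  have inj: "v = u" if "fo v = fo u" "fo v \<noteq> 0" for v u
    using B that unfolding backup_def by blast
  have "linked (su(w := x)) (pr(x := w, y := 0))"
    unfolding linked_def
  proof (intro conjI allI impI)
    show "(su(w := x)) 0 = 0" using L0 ne by simp
    show "(pr(x := w, y := 0)) 0 = 0" using L0 ne by simp
  next
    fix v assume "(su(w := x)) v \<noteq> 0"
    then show "arc v ((su(w := x)) v)" using L wx unfolding linked_def by auto
  next
    fix v u :: nat assume vu: "v \<noteq> 0" "u \<noteq> 0"
    show "(su(w := x)) v = u \<longleftrightarrow> (pr(x := w, y := 0)) u = v"
    proof (cases "v = w")
      case True
      then show ?thesis
        using su_pr[OF ne(1) vu(2)] vu yx by (auto simp: y_def w_def)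
    next
      case False
      then show ?thesis
        using su_pr[OF vu] vu yx yw x by auto
    qed
  qed
  moreover have "backup (su(w := x)) fo S"
    using B ne unfolding backup_def by auto
  moreover have "y \<le> n" using linked_le[OF L] unfolding y_def by blast
  moreover have "(pr(x := w, y := 0)) v \<noteq> 0" if "v < i" "v \<noteq> y" "fo v \<noteq> 0" for v
    using settled[OF that(1) _ that(3)] that ne by auto
  ultimately show "repairing (su(w := x)) (pr(x := w, y := 0)) fo S i y"
    unfolding repairing_def by blast
  \<comment> \<open>\<open>fo\<close> is injective, so \<open>w\<close> is the backup of
    \<open>x\<close> alone, and the arc given up, from \<open>w\<close> to \<open>y\<close>, is not
    a backup arc.\<close>
  have "(su(w := x)) (fo v) \<noteq> v \<Longrightarrow> fo v \<noteq> 0 \<Longrightarrow> su (fo v) \<noteq> v" for v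
    using inj[of v x] unfolding w_def by (cases "fo v = fo x") auto
  moreover have "su (fo x) \<noteq> x" using yx unfolding y_def by simp
  moreover have "x \<in> {1..n}" using arc_le[OF wx] by auto
  ultimately have "{v \<in> {1..n}. fo v \<noteq> 0 \<and> (su(w := x)) (fo v) \<noteq> v}
      \<subseteq> {v \<in> {1..n}. fo v \<noteq> 0 \<and> su (fo v) \<noteq> v}"
    and "x \<in> {v \<in> {1..n}. fo v \<noteq> 0 \<and> su (fo v) \<noteq> v}"
    using x by blast+
  moreover have "x \<notin> {v \<in> {1..n}. fo v \<noteq> 0 \<and> (su(w := x)) (fo v) \<noteq> v}"
    by (simp add: w_def)
  ultimately have "{v \<in> {1..n}. fo v \<noteq> 0 \<and> (su(w := x)) (fo v) \<noteq> v}
      \<subset> {v \<in> {1..n}. fo v \<noteq> 0 \<and> su (fo v) \<noteq> v}"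
    by blast
  then show "unsettled (su(w := x)) fo < unsettled su fo"
    unfolding unsettled_def by (intro psubset_card_mono) auto
qed

text \<open>An arc is dispensable if its tail has a predecessor and its head a successor; none is
  left with a tail below \<open>i\<close>. For \<open>i = Suc n\<close> this excludes cycles and
  limits paths to three vertices.\<close>

definition cutting :: "(nat \<Rightarrow> nat) \<Rightarrow> (nat \<Rightarrow> nat) \<Rightarrow> nat set \<Rightarrow> nat \<Rightarrow> bool" where
  "cutting su pr S i \<longleftrightarrow> linked su pr \<and> (\<forall>v\<in>S. su v \<noteq> 0 \<or> pr v \<noteq> 0) \<and>
     (\<forall>v<i. pr v = 0 \<or> su (su v) = 0)"

text \<open>A vertex of \<open>S\<close> without successor has a backup, and once all walks are over
  a backup entails a predecessor.\<close>

lemma repairing_cutting: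
  assumes "repairing su pr fo S (Suc n) 0" "S \<subseteq> {1..n}"
  shows "cutting su pr S (Suc 0)"
proof -
  have L: "linked su pr" and fo: "\<And>v. v \<in> S \<Longrightarrow> su v \<noteq> 0 \<or> fo v \<noteq> 0"
    and pr: "\<And>v. v < Suc n \<Longrightarrow> v \<noteq> 0 \<Longrightarrow> fo v \<noteq> 0 \<Longrightarrow> pr v \<noteq> 0"
    using assms(1) unfolding repairing_def backup_def by blast+
  have "su v \<noteq> 0 \<or> pr v \<noteq> 0" if "v \<in> S" for v
    using fo[OF that] pr[of v] that assms(2) by fastforce
  with L show ?thesis unfolding cutting_def linked_def by simp
qed

text \<open>After the deletion \<open>i\<close> keeps its predecessor and \<open>su i\<close> its
  successor, as these are two different vertices in the absence of loops. So no vertex of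
  \<open>S\<close> becomes isolated.\<close>

lemma cutting_step:
  assumes inv: "cutting su pr S i" and i: "pr i \<noteq> 0" "su (su i) \<noteq> 0"
    and loop_free: "\<And>v. \<not> arc v v"
  shows "cutting (su(i := 0)) (pr(su i := 0)) S (Suc i)"
proof -
  have L: "linked su pr" using inv unfolding cutting_def by blast
  define w where "w = su i"
  have su_pr: "su v = u \<longleftrightarrow> pr u = v" if "v \<noteq> 0" "u \<noteq> 0" for u v
    using L that unfolding linked_def by blast
  have L0: "su 0 = 0" "pr 0 = 0" using L unfolding linked_def by auto
  have ne: "i \<noteq> 0" "w \<noteq> 0" using i L0 unfolding w_def by (metis)+
  have "arc i w" using L ne unfolding w_def linked_def by blast
  with loop_free have iw: "i \<noteq> w" by auto
  have prw: "pr w = i" using su_pr[OF ne] unfolding w_def by simp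
  have "linked (su(i := 0)) (pr(w := 0))"
    unfolding linked_def
  proof (intro conjI allI impI)
    fix v u :: nat assume vu: "v \<noteq> 0" "u \<noteq> 0"
    show "(su(i := 0)) v = u \<longleftrightarrow> (pr(w := 0)) u = v"
      using su_pr[OF vu] vu prw by (auto simp: w_def)
  next
    fix v assume "(su(i := 0)) v \<noteq> 0"
    then show "arc v ((su(i := 0)) v)" using L unfolding linked_def by (auto split: if_splits)
  qed (use L0 in auto)
  moreover have "(su(i := 0)) v \<noteq> 0 \<or> (pr(w := 0)) v \<noteq> 0" if "v \<in> S" for v
    using inv that i iw unfolding cutting_def w_def by auto
  moreover have "(pr(w := 0)) v = 0 \<or> (su(i := 0)) ((su(i := 0)) v) = 0" if "v < Suc i" for v
  proof -
    have "pr v = 0 \<or> su (su v) = 0 \<or> v = i" using inv that unfolding cutting_def less_Suc_eq by blast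
    then show ?thesis using L0 ne by auto
  qed
  ultimately show ?thesis unfolding cutting_def w_def by blast
qed

end

section \<open>Verification of the orienting, repairing and cutting loops\<close>

context arc_input
begin

text \<open>\<open>P\<close> is a potential that pays for the part of the running time not covered by \<open>K\<close>.\<close>

lemma wp_for:
  assumes init: "I 1 (s\<lparr>reg := (reg s)(''i'' := 1)\<rparr>)"
    and P: "P (s\<lparr>reg := (reg s)(''i'' := 1)\<rparr>) + Suc K * n + 2 + R \<le> T"
    and n: "\<And>i s. I i s \<Longrightarrow> reg s ''n'' = n"
    and body: "\<And>i s T r. I i s \<Longrightarrow> reg s ''i'' = i \<Longrightarrow> 0 < i \<Longrightarrow> i \<le> n \<Longrightarrow> P s + K + r \<le> T \<Longrightarrow>
      wp W body (\<lambda>s T. I (Suc i) s \<and> reg s ''i'' = Suc i \<and> P s + r \<le> T) s T"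
    and Q: "\<And>s T. I (Suc n) s \<Longrightarrow> P s + R \<le> T \<Longrightarrow> Q s T"
  shows "wp W (Seq (Assign ''i'' (Const 1))
    (While (Less (Reg ''i'') (Add (Reg ''n'') (Const 1))) body)) Q s T"
proof -
  define J where "J = (\<lambda>s T. I (reg s ''i'') s \<and> 0 < reg s ''i'' \<and> reg s ''i'' \<le> Suc n \<and>
    P s + Suc K * (Suc n - reg s ''i'') + 1 + R \<le> T)"
  have "wp W (While (Less (Reg ''i'') (Add (Reg ''n'') (Const 1))) body) Q
    (s\<lparr>reg := (reg s)(''i'' := 1)\<rparr>) (T - 1)"
  proof (rule wp_While[where I = J])
    show "J (s\<lparr>reg := (reg s)(''i'' := 1)\<rparr>) (T - 1)"
      using init P by (simp add: J_def) arith
  next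
    fix s T assume "J s T" then show "1 \<le> T" by (auto simp: J_def)
  next
    fix s T assume J: "J s T" "\<not> bval (Less (Reg ''i'') (Add (Reg ''n'') (Const 1))) s"
    then have "reg s ''i'' = Suc n" using n by (auto simp: J_def)
    with J show "Q s (T - 1)" by (intro Q) (auto simp: J_def)
  next
    fix s T assume J: "J s T" and b: "bval (Less (Reg ''i'') (Add (Reg ''n'') (Const 1))) s"
    define i where "i = reg s ''i''"
    have i: "0 < i" "i \<le> n" "I i s" using J b n by (auto simp: J_def i_def)
    have "Suc K * (Suc n - i) = Suc K + Suc K * (n - i)" using i by (simp add: Suc_diff_le)
    moreover have "P s + Suc K * (Suc n - i) + 1 + R \<le> T" using J unfolding J_def i_def by blast
    ultimately have "P s + K + (Suc K * (Suc n - Suc i) + 1 + R) \<le> T - 1"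
      unfolding diff_Suc_Suc by linarith
    from body[OF i(3) i_def[symmetric] i(1,2) this] show "wp W body J s (T - 1)"
      by (rule wp_mono) (use i in \<open>auto simp: J_def\<close>)
  qed
  moreover have "1 < W" "1 \<le> T" using P word_bound by auto
  ultimately show ?thesis by simp
qed

text \<open>Cell \<open>0\<close> of \<open>start\<close> is carried along because the output phase
  relies on its initial value and never writes it.\<close>

definition orienting :: "(nat \<Rightarrow> nat) \<Rightarrow> nat \<Rightarrow> store \<Rightarrow> bool" where
  "orienting own i s \<longleftrightarrow> reg s ''n'' = n \<and> arr s ''own'' = own \<and> arr s ''start'' 0 = 0 \<and>
     (\<forall>w. arr s ''pr'' w = (if 0 < w \<and> w < i then own w else 0)) \<and>
     (\<forall>u w. u \<noteq> 0 \<longrightarrow> w \<noteq> 0 \<longrightarrow> arr s ''su'' u = w \<longleftrightarrow> w < i \<and> own w = u) \<and>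
     (\<forall>u w. u \<noteq> 0 \<longrightarrow> w \<noteq> 0 \<longrightarrow> arr s ''fo'' u = w \<longleftrightarrow> w < i \<and> own (n + w) = u)"

lemma orient_prog_correct:
  assumes mat: "matching s (Suc n) 0" and own: "own = arr s ''own''" and T: "7 * n + 4 + R \<le> T"
    and Q: "\<And>s T. reg s ''n'' = n \<Longrightarrow> arr s ''start'' 0 = 0 \<Longrightarrow>
      linked (arr s ''su'') (arr s ''pr'') \<Longrightarrow>
      backup (arr s ''su'') (arr s ''fo'') (range own - {0}) \<Longrightarrow> R \<le> T \<Longrightarrow> Q s T"
  shows "wp W orient_prog Q s T"
proof -
  obtain d ptr where act: "active own d ptr (Suc n) 0" and z: "zero_arrays s" "reg s ''n'' = n"
    using mat unfolding matching_def own cells_upto_def by blast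
  have le: "own a < W" for a using active_bounds(3)[OF act, of a] word_bound by simp
  have "stable own d ptr" using act unfolding active_def by blast
  then have "\<forall>a b. own a = own b \<longrightarrow> own a \<noteq> 0 \<longrightarrow> a = b" unfolding stable_def by (elim conjE)
  then have inj: "a = b" if "own a = own b" "own a \<noteq> 0" for a b using that by blast
  have "wp W (Seq (Assign ''i'' (Const 1))
    (While (Less (Reg ''i'') (Add (Reg ''n'') (Const 1))) orient_body))
    (wp W (Seq (Write ''su'' (Const 0) (Const 0)) (Write ''fo'' (Const 0) (Const 0))) Q) s T"
  proof (rule wp_for[where I = "orienting own" and P = "\<lambda>_. 0" and K = 6 and R = "R + 2"])
    show "orienting own 1 (s\<lparr>reg := (reg s)(''i'' := 1)\<rparr>)"
      using z by (auto simp: orienting_def own zero_arrays_def)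
  next
    fix i and s :: store and T r :: nat
    assume I: "orienting own i s" "reg s ''i'' = i" "0 < i" "i \<le> n" and T: "0 + 6 + r \<le> T"
    from T obtain T0 where T0: "T = T0 + 6" "r \<le> T0" by (intro that[of "T - 6"]) auto
    have b: "Suc i < W" using I word_bound by auto
    \<comment> \<open>A nonzero owner holds only one slot, so this write overwrites no earlier
      entry; the junk in cell \<open>0\<close> is not tracked.\<close>
    have su: "u \<noteq> 0 \<Longrightarrow> w \<noteq> 0 \<Longrightarrow>
      (if u = own i then i else arr s ''su'' u) = w \<longleftrightarrow> w < Suc i \<and> own w = u" for u w
      using I inj[of w i] by (auto simp: orienting_def less_Suc_eq)
    have fo: "u \<noteq> 0 \<Longrightarrow> w \<noteq> 0 \<Longrightarrow>
      (if u = own (n + i) then i else arr s ''fo'' u) = w \<longleftrightarrow> w < Suc i \<and> own (n + w) = u" for u w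
      using I inj[of "n + w" "n + i"] by (auto simp: orienting_def less_Suc_eq)
    show "wp W orient_body (\<lambda>s T. orienting own (Suc i) s \<and> reg s ''i'' = Suc i \<and> 0 + r \<le> T) s T"
      using I su fo le b T0(2) unfolding orient_body_def orienting_def
      by (auto simp: T0(1) less_Suc_eq)
  next
    fix s T assume I: "orienting own (Suc n) s" and T: "0 + (R + 2) \<le> T"
    let ?s = "s\<lparr>arr := (arr s)(''su'' := (arr s ''su'')(0 := 0), ''fo'' := (arr s ''fo'')(0 := 0))\<rparr>"
    have "linked (arr ?s ''su'') (arr ?s ''pr'')"
      "backup (arr ?s ''su'') (arr ?s ''fo'') (range own - {0})"
      using I orient_result[OF act, of "arr ?s ''pr''" "arr ?s ''su''" "arr ?s ''fo''"]
      by (simp_all add: orienting_def less_Suc_eq_le)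
    then have "Q ?s (T - 2)" using I T by (intro Q) (auto simp: orienting_def)
    then show "wp W (Seq (Write ''su'' (Const 0) (Const 0)) (Write ''fo'' (Const 0) (Const 0))) Q s T"
      using T word_bound by (simp add: numeral_2_eq_2)
  qed (use T in \<open>auto simp: orienting_def\<close>)
  then show ?thesis unfolding orient_prog_def by simp
qed

text \<open>A unit of \<open>unsettled\<close> pays for the 6 steps of an exchange and its loop
  test. By \<open>unsettled_le\<close> this amounts to \<open>7 * n\<close>, to which the outer loop
  adds \<open>4 * n\<close>.\<close>

lemma repair_prog_correct:
  assumes s: "reg s ''n'' = n" "arr s ''start'' 0 = 0" "linked (arr s ''su'') (arr s ''pr'')"
      "backup (arr s ''su'') (arr s ''fo'') S" "S \<subseteq> {1..n}"
    and T: "11 * n + 2 + R \<le> T"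
    and Q: "\<And>s T. reg s ''n'' = n \<Longrightarrow> arr s ''start'' 0 = 0 \<Longrightarrow>
      cutting (arr s ''su'') (arr s ''pr'') S 1 \<Longrightarrow> R \<le> T \<Longrightarrow> Q s T"
  shows "wp W repair_prog Q s T"
proof -
  define I where "I = (\<lambda>i x (s :: store). reg s ''n'' = n \<and> arr s ''start'' 0 = 0 \<and>
    repairing (arr s ''su'') (arr s ''pr'') (arr s ''fo'') S i x)"
  define P where "P = (\<lambda>s :: store. 7 * unsettled (arr s ''su'') (arr s ''fo''))"
  show ?thesis
    unfolding repair_prog_def
  proof (rule wp_for[where I = "\<lambda>i. I i 0" and P = P and K = 3 and R = R])
    show "I 1 0 (s\<lparr>reg := (reg s)(''i'' := 1)\<rparr>)"
      using s by (simp add: I_def repairing_def)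
    show "P (s\<lparr>reg := (reg s)(''i'' := 1)\<rparr>) + Suc 3 * n + 2 + R \<le> T"
      using T unsettled_le[of "arr s ''su''" "arr s ''fo''"] by (simp add: P_def)
  next
    fix s T assume "I (Suc n) 0 s" "P s + R \<le> T"
    then show "Q s T" using repairing_cutting s(5) by (intro Q) (auto simp: I_def)
  next
    fix i and s :: store and T r :: nat
    assume I: "I i 0 s" and i: "reg s ''i'' = i" "0 < i" "i \<le> n" and T: "P s + 3 + r \<le> T"
    define J where "J = (\<lambda>(s :: store) T. I (Suc i) (reg s ''x'') s \<and> reg s ''i'' = i \<and> P s + 2 + r \<le> T)"
    have start: "repairing (arr s ''su'') (arr s ''pr'') (arr s ''fo'') S (Suc i) i"
    proof -
      have R: "repairing (arr s ''su'') (arr s ''pr'') (arr s ''fo'') S i 0"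
        using I unfolding I_def by blast
      then have "arr s ''fo'' 0 = 0" unfolding repairing_def backup_def by blast
      moreover have "arr s ''pr'' v \<noteq> 0" if "v < i" "v \<noteq> 0" "arr s ''fo'' v \<noteq> 0" for v
        using R that unfolding repairing_def by blast
      ultimately have "arr s ''pr'' v \<noteq> 0" if "v < Suc i" "v \<noteq> i" "arr s ''fo'' v \<noteq> 0" for v
        using that by (cases "v = 0") auto
      with R i(3) show ?thesis unfolding repairing_def by blast
    qed
    have "wp W (While repair_cond repair_step)
      (wp W (Assign ''i'' (Add (Reg ''i'') (Const 1)))
        (\<lambda>s T. I (Suc i) 0 s \<and> reg s ''i'' = Suc i \<and> P s + r \<le> T))
      (s\<lparr>reg := (reg s)(''x'' := i)\<rparr>) (T - 1)"
    proof (rule wp_While[where I = J])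
      show "J (s\<lparr>reg := (reg s)(''x'' := i)\<rparr>) (T - 1)"
        using I T start by (simp add: J_def I_def P_def i(1)) arith
    next
      fix s T assume "J s T" then show "1 \<le> T" by (auto simp: J_def)
    next
      fix s T assume J: "J s T" "bval repair_cond s"
      define x su pr fo where
        "x = reg s ''x''" and "su = arr s ''su''" and "pr = arr s ''pr''" and "fo = arr s ''fo''"
      note folds = x_def[symmetric] su_def[symmetric] pr_def[symmetric] fo_def[symmetric]
      have inv: "repairing su pr fo S (Suc i) x" and x: "fo x \<noteq> 0" "pr x = 0"
        and regs: "reg s ''n'' = n" "arr s ''start'' 0 = 0" "reg s ''i'' = i"
        using J unfolding J_def I_def repair_cond_def by (auto simp: folds)
      note step = repairing_step[OF inv x]
      have L: "linked su pr" and xn: "x \<le> n" using inv unfolding repairing_def by auto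
      have "arc (fo x) x" using inv x unfolding repairing_def backup_def by blast
      then have b: "x < W" "fo x < W" "su v < W" for v
        using linked_le[OF L, of v] arc_le[of "fo x" x] word_bound by auto
      have "7 * unsettled (su(fo x := x)) fo + 9 + r \<le> T"
        using step(2) J unfolding J_def P_def folds by linarith
      then obtain T0 where T0: "T = T0 + 9" "7 * unsettled (su(fo x := x)) fo + r \<le> T0"
        by (intro that[of "T - 9"]) auto
      show "wp W repair_step J s (T - 1)"
        using step(1) b word_bound unfolding repair_step_def J_def I_def P_def
        by (simp add: folds T0(1) regs) (use T0(2) in linarith)
    next
      fix s T assume J: "J s T" "\<not> bval repair_cond s"
      have inv: "repairing (arr s ''su'') (arr s ''pr'') (arr s ''fo'') S (Suc i) (reg s ''x'')"
        using J unfolding J_def I_def by blast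
      \<comment> \<open>The walk stops at a vertex with a predecessor or without a backup, which no
        longer needs the exception granted to \<open>x\<close>.\<close>
      have "repairing (arr s ''su'') (arr s ''pr'') (arr s ''fo'') S (Suc i) 0"
        using inv J(2) unfolding repairing_def repair_cond_def by auto
      then show "wp W (Assign ''i'' (Add (Reg ''i'') (Const 1)))
        (\<lambda>s T. I (Suc i) 0 s \<and> reg s ''i'' = Suc i \<and> P s + r \<le> T) s (T - 1)"
        using J(1) i(3) word_bound by (auto simp: J_def I_def P_def)
    qed
    then show "wp W repair_body (\<lambda>s T. I (Suc i) 0 s \<and> reg s ''i'' = Suc i \<and> P s + r \<le> T) s T"
      using i T word_bound unfolding repair_body_def by simp
  qed (auto simp: I_def)
qed

lemma cut_prog_correct:
  assumes s: "reg s ''n'' = n" "arr s ''start'' 0 = 0"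
      "cutting (arr s ''su'') (arr s ''pr'') S 1"
    and loop_free: "\<And>v. \<not> arc v v"
    and T: "6 * n + 2 + R \<le> T"
    and Q: "\<And>s T. reg s ''n'' = n \<Longrightarrow> arr s ''start'' 0 = 0 \<Longrightarrow>
      cutting (arr s ''su'') (arr s ''pr'') S (Suc n) \<Longrightarrow> R \<le> T \<Longrightarrow> Q s T"
  shows "wp W cut_prog Q s T"
proof -
  define I where "I = (\<lambda>i (s :: store). reg s ''n'' = n \<and> arr s ''start'' 0 = 0 \<and>
    cutting (arr s ''su'') (arr s ''pr'') S i)"
  show ?thesis
    unfolding cut_prog_def
  proof (rule wp_for[where I = I and P = "\<lambda>_. 0" and K = 5 and R = R])
    fix i and s :: store and T r :: nat
    assume I: "I i s" and i: "reg s ''i'' = i" "0 < i" "i \<le> n" and T: "0 + 5 + r \<le> T"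
    from T obtain T0 where T0: "T = T0 + 5" "r \<le> T0" by (intro that[of "T - 5"]) auto
    define su pr where "su = arr s ''su''" and "pr = arr s ''pr''"
    note folds = su_def[symmetric] pr_def[symmetric]
    have inv: "cutting su pr S i" and regs: "reg s ''n'' = n" "arr s ''start'' 0 = 0"
      using I unfolding I_def folds by auto
    have L: "linked su pr" using inv unfolding cutting_def by blast
    have b: "i < W" "su v < W" for v using linked_le[OF L, of v] i word_bound by auto
    have skip: "cutting su pr S (Suc i)" if "pr i = 0 \<or> su (su i) = 0"
      using inv that unfolding cutting_def by (auto simp: less_Suc_eq)
    show "wp W cut_body (\<lambda>s T. I (Suc i) s \<and> reg s ''i'' = Suc i \<and> 0 + r \<le> T) s T"
    proof (cases "pr i = 0 \<or> su (su i) = 0")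
      case True
      then show ?thesis using skip b word_bound i(2,3) T0(2) unfolding cut_body_def I_def
        by (auto simp: folds T0(1) regs i(1))
    next
      case False
      then have "cutting (su(i := 0)) (pr(su i := 0)) S (Suc i)"
        by (intro cutting_step[OF inv] loop_free) auto
      with False show ?thesis using b word_bound i(2,3) T0(2) unfolding cut_body_def I_def
        by (auto simp: folds T0(1) regs i(1))
    qed
  qed (use s T Q in \<open>auto simp: I_def\<close>)
qed

end

section \<open>Writing the paths into the output arrays\<close>

definition emit_path :: com where
  "emit_path =
    Seq (Write ''out'' (Reg ''p'') (Sub (Reg ''i'') (Const 1)))
    (Seq (Assign ''p'' (Add (Reg ''p'') (Const 1)))
    (Seq (Assign ''w'' (Read ''su'' (Reg ''i'')))
    (Seq (Cond (Less (Const 0) (Reg ''w''))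
           (Seq (Write ''out'' (Reg ''p'') (Sub (Reg ''w'') (Const 1)))
           (Seq (Assign ''p'' (Add (Reg ''p'') (Const 1)))
           (Seq (Assign ''w'' (Read ''su'' (Reg ''w'')))
                (Cond (Less (Const 0) (Reg ''w''))
                  (Seq (Write ''out'' (Reg ''p'') (Sub (Reg ''w'') (Const 1)))
                       (Assign ''p'' (Add (Reg ''p'') (Const 1))))
                  Skip))))
           Skip)
    (Seq (Assign ''count'' (Add (Reg ''count'') (Const 1)))
         (Write ''start'' (Reg ''count'') (Reg ''p''))))))"

definition emit_body :: com where
  "emit_body =
    Seq (Cond (Equal (Read ''pr'' (Reg ''i'')) (Const 0)) emit_path Skip)
        (Assign ''i'' (Add (Reg ''i'') (Const 1)))"

definition emit_prog :: com where
  "emit_prog =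
    Seq (Assign ''count'' (Const 0))
    (Seq (Assign ''p'' (Const 0))
    (Seq (Assign ''i'' (Const 1))
         (While (Less (Reg ''i'') (Add (Reg ''n'') (Const 1))) emit_body)))"

text \<open>The end of a path is the start of the next one, so \<open>cnt\<close> paths fill the
  cells \<open>0\<close> to \<open>cnt\<close> of \<open>start\<close>.\<close>

definition emitted :: "(nat \<Rightarrow> nat) \<Rightarrow> (nat \<Rightarrow> nat) \<Rightarrow> nat \<Rightarrow> nat \<Rightarrow> nat list list \<Rightarrow> bool" where
  "emitted out start cnt p ps \<longleftrightarrow> cnt = length ps \<and> p = length (concat ps) \<and>
     (\<forall>j<p. out j = concat ps ! j) \<and> (\<forall>j\<le>cnt. start j = length (concat (take j ps)))"

lemma emitted_append:
  assumes "emitted out start cnt p ps"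
    and "\<And>j. j < p \<Longrightarrow> out' j = out j" "\<And>j. j < length q \<Longrightarrow> out' (p + j) = q ! j"
  shows "emitted out' (start(Suc cnt := p + length q)) (Suc cnt) (p + length q) (ps @ [q])"
proof -
  have "out' j = concat (ps @ [q]) ! j" if "j < p + length q" for j
    using assms(1) assms(2)[of j] assms(3)[of "j - p"] that
    by (cases "j < p") (auto simp: emitted_def nth_append)
  with assms(1) show ?thesis by (auto simp: emitted_def le_Suc_eq)
qed

lemma emitted_output:
  assumes "emitted (arr s ''out'') (arr s ''start'') (reg s ''count'') p ps"
  shows "output_paths s = ps"
proof (rule nth_equalityI)
  show len: "length (output_paths s) = length ps"
    using assms by (simp add: output_paths_def emitted_def)
  fix i assume "i < length (output_paths s)"
  with len have i: "i < length ps" by simp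
  define a where "a = length (concat (take i ps))"
  have start: "arr s ''start'' i = a" "arr s ''start'' (i + 1) = a + length (ps ! i)"
    using assms i by (auto simp: emitted_def a_def take_Suc_conv_app_nth)
  have "ps = take i ps @ ps ! i # drop (Suc i) ps" using i by (rule id_take_nth_drop)
  then have c: "concat ps = concat (take i ps) @ ps ! i @ concat (drop (Suc i) ps)"
    by (metis concat.simps(2) concat_append)
  have "arr s ''out'' (a + j) = ps ! i ! j" if "j < length (ps ! i)" for j
  proof -
    have "a + j < length (concat ps)" using that unfolding c by (simp add: a_def)
    then have "arr s ''out'' (a + j) = concat ps ! (a + j)"
      using assms by (simp add: emitted_def)
    also have "\<dots> = ps ! i ! j" using that unfolding c by (simp add: a_def nth_append)
    finally show ?thesis .
  qed
  then have "map (arr s ''out'') [a..<a + length (ps ! i)] = ps ! i"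
    by (intro nth_equalityI) auto
  then show "output_paths s ! i = ps ! i"
    using i assms start by (simp add: output_paths_def emitted_def)
qed

text \<open>Three candidates suffice once the arcs have been cut. Missing successors are filtered
  out before the shift by one is undone, as \<open>0\<close> would otherwise turn into a
  vertex.\<close>

definition path_from :: "(nat \<Rightarrow> nat) \<Rightarrow> nat \<Rightarrow> nat list" where
  "path_from su v = map (\<lambda>x. x - 1) (filter (\<lambda>x. x \<noteq> 0) [v, su v, su (su v)])"

definition paths_below :: "(nat \<Rightarrow> nat) \<Rightarrow> (nat \<Rightarrow> nat) \<Rightarrow> nat \<Rightarrow> nat list list" where
  "paths_below su pr i = map (path_from su) (filter (\<lambda>v. pr v = 0) [1..<i])"

lemma paths_below_Suc:
  "0 < i \<Longrightarrow> paths_below su pr (Suc i) =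
    paths_below su pr i @ (if pr i = 0 then [path_from su i] else [])"
  by (simp add: paths_below_def)

lemma length_paths_below: "length (paths_below su pr i) \<le> i"
  unfolding paths_below_def by (simp add: le_trans[OF length_filter_le])

lemma length_concat_paths_below: "length (concat (paths_below su pr i)) \<le> 3 * i"
proof (induction i)
  case (Suc i)
  have "length (path_from su i) \<le> 3"
    unfolding path_from_def length_map by (rule le_trans[OF length_filter_le]) simp
  with Suc show ?case by (cases "i = 0") (auto simp: paths_below_Suc paths_below_def)
qed (simp add: paths_below_def)

context arc_input
begin

lemma emit_path_correct:
  assumes em: "emitted (arr s ''out'') (arr s ''start'') (reg s ''count'') (reg s ''p'') ps"
    and b: "reg s ''p'' \<le> 3 * n" "reg s ''count'' \<le> n"
    and i: "reg s ''i'' = i" "0 < i" "i \<le> n" and su: "arr s ''su'' = su" "su 0 = 0" "\<And>v. su v \<le> n"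
    and T: "13 + r \<le> T"
    and Q: "\<And>s' T. emitted (arr s' ''out'') (arr s' ''start'') (reg s' ''count'') (reg s' ''p'')
        (ps @ [path_from su i]) \<Longrightarrow> reg s' ''n'' = reg s ''n'' \<Longrightarrow> reg s' ''i'' = i \<Longrightarrow>
        arr s' ''su'' = su \<Longrightarrow> arr s' ''pr'' = arr s ''pr'' \<Longrightarrow> r \<le> T \<Longrightarrow> Q s' T"
  shows "wp W emit_path Q s T"
proof -
  define out start cnt p where
    "out = arr s ''out''" and "start = arr s ''start''" and
    "cnt = reg s ''count''" and "p = reg s ''p''"
  note folds = out_def[symmetric] start_def[symmetric] cnt_def[symmetric] p_def[symmetric]
  have em: "emitted out start cnt p ps" and b: "p \<le> 3 * n" "cnt \<le> n"
    using em b by (simp_all add: folds)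
  from T obtain T0 where T0: "T = T0 + 13" "r \<le> T0" by (intro that[of "T - 13"]) auto
  have W: "i < W" "su v < W" "i - Suc 0 < W" "su v - Suc 0 < W" "Suc cnt < W" "p < W" "Suc p < W"
      "Suc (Suc p) < W" "Suc (Suc (Suc p)) < W" for v
    using b i su(3)[of v] word_bound by auto
  consider "su i = 0" | "su i \<noteq> 0" "su (su i) = 0" | "su i \<noteq> 0" "su (su i) \<noteq> 0" by blast
  then show ?thesis
  proof cases
    case 1
    then have "emitted (out(p := i - 1)) (start(Suc cnt := Suc p)) (Suc cnt) (Suc p)
        (ps @ [path_from su i])"
      using emitted_append[OF em, of "out(p := i - 1)" "path_from su i"] i(2) su(2)
      by (simp add: path_from_def)
    with 1 show ?thesis using W T0(2) unfolding emit_path_def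
      by (auto simp: folds T0(1) i(1) su(1) intro!: Q)
  next
    case 2
    then have q: "path_from su i = [i - 1, su i - 1]" using i(2) by (simp add: path_from_def)
    have "emitted (out(p := i - 1, Suc p := su i - 1)) (start(Suc cnt := p + length (path_from su i)))
        (Suc cnt) (p + length (path_from su i)) (ps @ [path_from su i])"
      unfolding q by (rule emitted_append[OF em]) (auto simp: less_Suc_eq)
    then have "emitted (out(p := i - 1, Suc p := su i - 1)) (start(Suc cnt := Suc (Suc p)))
        (Suc cnt) (Suc (Suc p)) (ps @ [path_from su i])"
      by (simp add: q)
    with 2 show ?thesis using W T0(2) unfolding emit_path_def
      by (auto simp: folds T0(1) i(1) su(1) intro!: Q)
  next
    case 3
    then have q: "path_from su i = [i - 1, su i - 1, su (su i) - 1]"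
      using i(2) by (simp add: path_from_def)
    let ?out = "out(p := i - 1, Suc p := su i - 1, Suc (Suc p) := su (su i) - 1)"
    have "emitted ?out (start(Suc cnt := p + length (path_from su i)))
        (Suc cnt) (p + length (path_from su i)) (ps @ [path_from su i])"
      unfolding q by (rule emitted_append[OF em]) (auto simp: less_Suc_eq)
    then have "emitted ?out (start(Suc cnt := Suc (Suc (Suc p)))) (Suc cnt) (Suc (Suc (Suc p)))
        (ps @ [path_from su i])"
      by (simp add: q)
    with 3 show ?thesis using W T0(2) unfolding emit_path_def
      by (auto simp: folds T0(1) i(1) su(1) intro!: Q)
  qed
qed

lemma emit_prog_correct:
  assumes s: "reg s ''n'' = n" "arr s ''start'' 0 = 0" "arr s ''su'' = su" "arr s ''pr'' = pr"
      "linked su pr"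
    and T: "16 * n + 4 + R \<le> T"
    and Q: "\<And>s T. output_paths s = paths_below su pr (Suc n) \<Longrightarrow> R \<le> T \<Longrightarrow> Q s T"
  shows "wp W emit_prog Q s T"
proof -
  define I where "I = (\<lambda>i (s :: store). reg s ''n'' = n \<and> arr s ''su'' = su \<and> arr s ''pr'' = pr \<and>
    emitted (arr s ''out'') (arr s ''start'') (reg s ''count'') (reg s ''p'') (paths_below su pr i))"
  have su: "su 0 = 0" "su v \<le> n" for v
    using s(5) linked_le[OF s(5), of v] unfolding linked_def by auto
  let ?s = "s\<lparr>reg := (reg s)(''count'' := 0, ''p'' := 0)\<rparr>"
  have "wp W (Seq (Assign ''i'' (Const 1))
    (While (Less (Reg ''i'') (Add (Reg ''n'') (Const 1))) emit_body)) Q ?s (T - 2)"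
  proof (rule wp_for[where I = I and P = "\<lambda>_. 0" and K = 15 and R = R])
    show "I 1 (?s\<lparr>reg := (reg ?s)(''i'' := 1)\<rparr>)"
      using s by (simp add: I_def emitted_def paths_below_def)
    show "0 + Suc 15 * n + 2 + R \<le> T - 2" using T by simp
  next
    fix s T assume "I (Suc n) s" "0 + R \<le> T"
    then show "Q s T" using emitted_output by (intro Q) (auto simp: I_def)
  next
    fix i and s :: store and T r :: nat
    assume I: "I i s" and i: "reg s ''i'' = i" "0 < i" "i \<le> n" and T: "0 + 15 + r \<le> T"
    have em: "emitted (arr s ''out'') (arr s ''start'') (reg s ''count'') (reg s ''p'')
        (paths_below su pr i)" and regs: "reg s ''n'' = n" "arr s ''su'' = su" "arr s ''pr'' = pr"
      using I unfolding I_def by auto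
    have b: "reg s ''p'' \<le> 3 * n" "reg s ''count'' \<le> n"
      using em i(3) length_concat_paths_below[of su pr i] length_paths_below[of su pr i]
      unfolding emitted_def by auto
    have W: "Suc i < W" using i word_bound by auto
    show "wp W emit_body (\<lambda>s T. I (Suc i) s \<and> reg s ''i'' = Suc i \<and> 0 + r \<le> T) s T"
    proof (cases "pr i = 0")
      case True
      have "wp W emit_path (wp W (Assign ''i'' (Add (Reg ''i'') (Const 1)))
        (\<lambda>s T. I (Suc i) s \<and> reg s ''i'' = Suc i \<and> 0 + r \<le> T)) s (T - 1)"
        by (rule emit_path_correct[OF em b i regs(2) su, where r = "Suc r"])
          (use T W True i(2) regs in \<open>auto simp: I_def paths_below_Suc\<close>)
      with True T show ?thesis unfolding emit_body_def by (simp add: i(1) regs)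
    next
      case False
      from T obtain T0 where T0: "T = T0 + 15" "r \<le> T0" by (intro that[of "T - 15"]) auto
      from False em W T0(2) show ?thesis unfolding emit_body_def I_def
        by (simp add: i(1) regs T0(1) paths_below_Suc[OF i(2)])
    qed
  qed (simp add: I_def)
  moreover have "0 < W" "2 \<le> T" using word_bound T by auto
  ultimately show ?thesis unfolding emit_prog_def by (simp add: numeral_2_eq_2)
qed

end

section \<open>The approximation guarantee\<close>

locale path_input = arc_input n es W
  for n :: nat and es :: "(nat \<times> nat) list" and W :: nat +
  fixes G :: "nat pair_pre_digraph"
  assumes pverts_G: "pverts G = {..<n}" and parcs_G: "parcs G = set es"
    and pair_digraph_G: "pair_digraph G"
begin

lemma loop_free: "\<not> arc v v"
proof
  assume "arc v v"
  then have "(v - 1, v - 1) \<in> parcs G" unfolding arc_def parcs_G by simp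
  with pair_loopfree_digraph.pair_no_loops[OF pair_digraph.axioms(2)[OF pair_digraph_G]]
  show False by fastforce
qed

lemma vpath_nth_arc:
  assumes "vwalk p (with_proj G)" "Suc j < length p"
  shows "(p ! j, p ! Suc j) \<in> set es"
proof -
  have "(p ! j, p ! Suc j) \<in> set (vwalk_arcs p)" using assms(2)
  proof (induction p arbitrary: j rule: vwalk_arcs.induct)
    case (3 x y xs)
    then show ?case by (cases j) auto
  qed auto
  with assms(1) show ?thesis unfolding vwalk_def by (auto simp: parcs_G)
qed

lemma finite_k_path_partition:
  assumes "k_path_partition k (with_proj G) Q"
  shows "finite Q"
proof (rule finite_subset)
  show "Q \<subseteq> {xs. set xs \<subseteq> {..<n} \<and> length xs \<le> k}"
    using assms by (auto simp: k_path_partition_def vpath_def vwalk_def pverts_G)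
  show "finite {xs. set xs \<subseteq> {..<n} \<and> length xs \<le> k}" by (rule finite_lists_length_le) simp
qed

lemma singletons_bound:
  assumes Q: "k_path_partition k (with_proj G) Q" and k: "2 \<le> k"
  shows "n + card {v. [v] \<in> Q} \<le> k * card Q"
proof -
  have fin: "finite Q" using finite_k_path_partition[OF Q] .
  define Q1 where "Q1 = {p \<in> Q. length p = 1}"
  have Q1: "Q1 = (\<lambda>v. [v]) ` {v. [v] \<in> Q}"
    unfolding Q1_def by (auto simp: length_Suc_conv)
  have "{..<n} \<subseteq> (\<Union>p\<in>Q. set p)" using Q by (auto simp: k_path_partition_def pverts_G)
  then have "n \<le> card (\<Union>p\<in>Q. set p)" using fin card_mono[of "\<Union>p\<in>Q. set p" "{..<n}"] by simp
  also have "\<dots> \<le> (\<Sum>p\<in>Q. card (set p))" using fin by (rule card_UN_le)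
  also have "\<dots> \<le> (\<Sum>p\<in>Q. length p)" by (intro sum_mono card_length)
  finally have "n + card Q1 \<le> (\<Sum>p\<in>Q. length p) + (\<Sum>p\<in>Q. if length p = 1 then 1 else 0)"
    unfolding Q1_def using fin by (simp add: sum.If_cases Int_def)
  also have "\<dots> = (\<Sum>p\<in>Q. length p + (if length p = 1 then 1 else 0))" by (simp add: sum.distrib)
  also have "\<dots> \<le> (\<Sum>p\<in>Q. k)"
    using Q k by (intro sum_mono) (auto simp: k_path_partition_def)
  finally have "n + card Q1 \<le> k * card Q" by (simp add: mult.commute)
  moreover have "card Q1 = card {v. [v] \<in> Q}" unfolding Q1 by (intro card_image) (auto simp: inj_on_def)
  ultimately show ?thesis by simp
qed

text \<open>
  In a path with at least two vertices the first vertex claims the slot for the arc into the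
  second one, and every other vertex the slot for the arc out of its predecessor.
\<close>

lemma partition_slots:
  assumes Q: "k_path_partition k (with_proj G) Q"
  defines "T \<equiv> {1..n} - Suc ` {v. [v] \<in> Q}"
  shows "\<exists>g. inj_on g T \<and>
    (\<forall>v\<in>T. \<exists>c\<in>{1..2 * m}. cell_vertex es c = v \<and> cell_slot n es c = g v)"
proof -
  have walk: "vwalk p (with_proj G)" and dist: "distinct p" if "p \<in> Q" for p
    using Q that unfolding k_path_partition_def vpath_def by auto
  have disj: "p = q" if "p \<in> Q" "q \<in> Q" "x \<in> set p" "x \<in> set q" for p q x
    using Q that unfolding k_path_partition_def by blast
  have "\<exists>p j. p \<in> Q \<and> j < length p \<and> p ! j = v - 1 \<and> 2 \<le> length p" if v: "v \<in> T" for v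
  proof -
    have "v - 1 \<in> pverts G" using v by (auto simp: T_def pverts_G)
    then obtain p where p: "p \<in> Q" "v - 1 \<in> set p" using Q by (auto simp: k_path_partition_def)
    then obtain j where j: "j < length p" "p ! j = v - 1" by (auto simp: in_set_conv_nth)
    have "length p \<noteq> 1"
    proof
      assume "length p = 1"
      with p have "p = [v - 1]" by (auto simp: length_Suc_conv)
      with p v have "Suc (v - 1) \<in> Suc ` {v. [v] \<in> Q}" by blast
      with v show False unfolding T_def by auto
    qed
    with p j show ?thesis by (intro exI[of _ p] exI[of _ j]) auto
  qed
  then obtain P J where PJ: "\<And>v. v \<in> T \<Longrightarrow>
      P v \<in> Q \<and> J v < length (P v) \<and> P v ! J v = v - 1 \<and> 2 \<le> length (P v)"
    by metis
  define g where "g v = (if J v = 0 then Suc (P v ! 1) else n + Suc (P v ! (J v - 1)))" for v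
  have lt: "P v ! j < n" if "v \<in> T" "j < length (P v)" for v j
    using walk[of "P v"] PJ[OF that(1)] nth_mem[OF that(2)] by (auto simp: vwalk_def pverts_G)
  have v_eq: "v = Suc (P v ! J v)" if "v \<in> T" for v
    using PJ[OF that] that by (auto simp: T_def)
  have "inj_on g T"
  proof (rule inj_onI)
    fix u v assume u: "u \<in> T" and v: "v \<in> T" and eq: "g u = g v"
    \<comment> \<open>In-slots are at most \<open>n\<close> and out-slots are larger, so equal slots
      are of the same kind.\<close>
    have l: "P u ! 1 < n" "P v ! 1 < n" using lt[OF u, of 1] lt[OF v, of 1] PJ[OF u] PJ[OF v] by auto
    show "u = v"
    proof (cases "J u = 0")
      case True
      with eq l have Jv: "J v = 0" unfolding g_def by (auto split: if_splits)
      with True eq have "P u ! 1 = P v ! 1" unfolding g_def by simp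
      moreover have "P u ! 1 \<in> set (P u)" "P v ! 1 \<in> set (P v)" using PJ[OF u] PJ[OF v] by auto
      ultimately have "P u = P v" using PJ[OF u] PJ[OF v] disj by metis
      with v_eq[OF u] v_eq[OF v] True Jv show ?thesis by simp
    next
      case False
      with eq l have Jv: "J v \<noteq> 0" unfolding g_def by (auto split: if_splits)
      with False eq have e: "P u ! (J u - 1) = P v ! (J v - 1)" unfolding g_def by simp
      moreover have "P u ! (J u - 1) \<in> set (P u)" "P v ! (J v - 1) \<in> set (P v)"
        using PJ[OF u] PJ[OF v] by auto
      ultimately have P: "P u = P v" using PJ[OF u] PJ[OF v] disj by metis
      have "P v \<in> Q" "J u - 1 < length (P v)" "J v - 1 < length (P v)"
        using PJ[OF u] PJ[OF v] unfolding P by auto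
      then have "J u - 1 = J v - 1"
        using e unfolding P using nth_eq_iff_index_eq[OF dist] by blast
      with False Jv have "J u = J v" by simp
      with P v_eq[OF u] v_eq[OF v] show ?thesis by simp
    qed
  qed
  moreover have "\<exists>c\<in>{1..2 * m}. cell_vertex es c = v \<and> cell_slot n es c = g v" if v: "v \<in> T" for v
  proof (cases "J v = 0")
    case True
    have "(P v ! 0, P v ! 1) \<in> set es"
      using vpath_nth_arc[OF walk, of "P v" 0] PJ[OF v] by simp
    then obtain i where i: "i < m" "es ! i = (P v ! 0, P v ! 1)" by (auto simp: in_set_conv_nth)
    with True v_eq[OF v] show ?thesis by (intro bexI[of _ "Suc (2 * i)"]) (auto simp: g_def)
  next
    case False
    have "(P v ! (J v - 1), P v ! J v) \<in> set es"
      using vpath_nth_arc[OF walk, of "P v" "J v - 1"] PJ[OF v] False by simp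
    then obtain i where i: "i < m" "es ! i = (P v ! (J v - 1), P v ! J v)"
      by (auto simp: in_set_conv_nth)
    with False v_eq[OF v] show ?thesis by (intro bexI[of _ "Suc (Suc (2 * i))"]) (auto simp: g_def)
  qed
  ultimately show ?thesis by blast
qed

section \<open>The produced paths and their number\<close>

definition heads :: "(nat \<Rightarrow> nat) \<Rightarrow> nat set" where
  "heads pr = {v \<in> {1..n}. pr v = 0}"

lemma set_paths: "set (paths_below su pr (Suc n)) = path_from su ` heads pr"
  unfolding paths_below_def heads_def by auto

lemma set_path_from: "set (path_from su v) = (\<lambda>x. x - 1) ` ({v, su v, su (su v)} - {0})"
  unfolding path_from_def by auto

context
  fixes su pr S
  assumes cut: "cutting su pr S (Suc n)"
begin

lemma linked: "linked su pr" using cut unfolding cutting_def by blast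

lemma su_pr: "v \<noteq> 0 \<Longrightarrow> u \<noteq> 0 \<Longrightarrow> su v = u \<longleftrightarrow> pr u = v"
  using linked unfolding linked_def by blast

lemma su_pr_0: "su 0 = 0" "pr 0 = 0" using linked unfolding linked_def by auto

lemma su_arc: "su v \<noteq> 0 \<Longrightarrow> arc v (su v)" using linked unfolding linked_def by blast

lemma pr_su: "su v \<noteq> 0 \<Longrightarrow> pr (su v) = v"
  using su_pr[of v "su v"] su_pr_0 by (cases "v = 0") auto

lemma su_pr_id: "pr v \<noteq> 0 \<Longrightarrow> su (pr v) = v"
  using su_pr[of "pr v" v] su_pr_0 by (cases "v = 0") auto

text \<open>Following \<open>pr\<close> at most twice from a vertex of a path leads back to its
  head, so the vertex determines the head.\<close>

lemma path_from_inj: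
  assumes v: "v \<in> heads pr" "w \<in> heads pr" and x: "x \<in> set (path_from su v)" "x \<in> set (path_from su w)"
  shows "v = w"
proof -
  define root where "root y = (if pr y = 0 then y else if pr (pr y) = 0 then pr y else pr (pr y))" for y
  have "root (Suc x) = u" if "u \<in> heads pr" "x \<in> set (path_from su u)" for u
  proof -
    have u: "u \<noteq> 0" "pr u = 0" using that unfolding heads_def by auto
    from that(2) consider "Suc x = u" | "Suc x = su u" "su u \<noteq> 0"
      | "Suc x = su (su u)" "su (su u) \<noteq> 0" "su u \<noteq> 0"
      unfolding set_path_from using su_pr_0 by force
    then show ?thesis
      by cases (use u in \<open>simp_all add: root_def pr_su\<close>)
  qed
  with v x show ?thesis by metis
qed

lemma paths_partition:
  assumes k: "3 \<le> k"
  shows "k_path_partition k (with_proj G) (set (paths_below su pr (Suc n)))"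
  unfolding k_path_partition_def set_paths
proof (intro conjI ballI impI)
  fix p assume "p \<in> path_from su ` heads pr"
  then obtain v where v: "v \<in> {1..n}" "pr v = 0" and p: "p = path_from su v"
    unfolding heads_def by auto
  have "length p \<le> 3" unfolding p path_from_def length_map
    by (rule le_trans[OF length_filter_le]) simp
  with k show "length p \<le> k" by simp
  have a1: "su v \<noteq> 0 \<Longrightarrow> arc v (su v)" and a2: "su (su v) \<noteq> 0 \<Longrightarrow> arc (su v) (su (su v))"
    using su_arc by auto
  \<comment> \<open>A head has no predecessor, so its path cannot return to it.\<close>
  have ne: "su v \<noteq> v" "su (su v) \<noteq> v" if "su v \<noteq> 0"
    using pr_su[of v] pr_su[of "su v"] that v by (auto simp: su_pr_0)
  have ne2: "su (su v) \<noteq> su v" if "su (su v) \<noteq> 0" using loop_free a2 that by metis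
  show "vpath p (with_proj G)"
  proof (cases "su v = 0")
    case True
    then show ?thesis using v su_pr_0
      by (auto simp: p path_from_def vpath_def vwalk_def pverts_G)
  next
    case False
    with a1 have 1: "arc v (su v)" .
    from arc_le[OF 1] 1 False ne v show ?thesis
    proof (cases "su (su v) = 0")
      case True
      with arc_le[OF 1] 1 False ne v show ?thesis
        by (auto simp: p path_from_def vpath_def vwalk_def pverts_G parcs_G arc_def)
    next
      case False2: False
      with a2 have 2: "arc (su v) (su (su v))" .
      from False2 ne2 have "su (su v) \<noteq> su v" by blast
      with arc_le[OF 1] arc_le[OF 2] 1 2 False False2 ne v show ?thesis
        by (auto simp: p path_from_def vpath_def vwalk_def pverts_G parcs_G arc_def)
    qed
  qed
next
  fix p q assume "p \<in> path_from su ` heads pr" "q \<in> path_from su ` heads pr" "p \<noteq> q"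
  then show "set p \<inter> set q = {}" using path_from_inj by blast
next
  fix x assume "x \<in> verts (with_proj G)"
  then have x: "Suc x \<in> {1..n}" by (auto simp: pverts_G)
  have mem: "\<exists>p\<in>path_from su ` heads pr. x \<in> set p"
    if "u \<in> heads pr" "Suc x \<in> {u, su u, su (su u)}" for u
  proof -
    have "x \<in> set (path_from su u)"
      unfolding set_path_from using that(2) by (intro image_eqI[of _ _ "Suc x"]) auto
    with that(1) show ?thesis by blast
  qed
  define y where "y = pr (Suc x)"
  define z where "z = pr y"
  show "\<exists>p\<in>path_from su ` heads pr. x \<in> set p"
  proof (cases "y = 0")
    case True
    with x show ?thesis by (intro mem[of "Suc x"]) (auto simp: heads_def y_def)
  next
    case False
    then have sy: "su y = Suc x" using su_pr_id unfolding y_def by blast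
    have yn: "y \<in> {1..n}" using arc_le[OF su_arc[of y]] sy by auto
    show ?thesis
    proof (cases "z = 0")
      case True
      with sy yn show ?thesis by (intro mem[of y]) (auto simp: heads_def z_def)
    next
      case False
      then have sz: "su z = y" using su_pr_id unfolding z_def by blast
      have zn: "z \<in> {1..n}" using arc_le[OF su_arc[of z]] sz \<open>y \<noteq> 0\<close> by auto
      \<comment> \<open>The arc from \<open>z\<close> to \<open>y\<close> survived the cutting
        although \<open>y\<close> has a successor, so \<open>z\<close> has no predecessor: going
        back at most two arcs reaches a head.\<close>
      have "pr z = 0 \<or> su (su z) = 0" using cut zn unfolding cutting_def by auto
      then have "pr z = 0" using sz sy by simp
      with sz sy zn show ?thesis by (intro mem[of z]) (auto simp: heads_def)
    qed
  qed
qed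

lemma inj_path_from: "inj_on (path_from su) (heads pr)"
proof (rule inj_onI)
  fix v w assume vw: "v \<in> heads pr" "w \<in> heads pr" "path_from su v = path_from su w"
  have "v - 1 \<in> set (path_from su v)" using vw(1) by (auto simp: set_path_from heads_def)
  with vw show "v = w" using path_from_inj by metis
qed

lemma distinct_paths: "distinct (paths_below su pr (Suc n))"
proof -
  have "set (filter (\<lambda>v. pr v = 0) [1..<Suc n]) \<subseteq> heads pr" by (auto simp: heads_def)
  then show ?thesis
    unfolding paths_below_def using inj_path_from by (auto simp: distinct_map intro: inj_on_subset)
qed

text \<open>A head without successor is isolated and hence outside \<open>S\<close>. The other heads
  are mapped injectively by \<open>su\<close> to vertices that are not heads. So
  \<open>card (heads pr) \<le> (n - card S) + (n - card (heads pr))\<close>.\<close>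

lemma heads_bound:
  assumes "S \<subseteq> {1..n}"
  shows "2 * card (heads pr) + card S \<le> 2 * n"
proof -
  define iso where "iso = {v \<in> heads pr. su v = 0}"
  have iso_S: "iso \<subseteq> {1..n} - S" using cut unfolding iso_def heads_def cutting_def by auto
  have "card iso \<le> card ({1..n} - S)" by (rule card_mono[OF _ iso_S]) simp
  also have "\<dots> = n - card S" using assms finite_subset[OF assms] by (simp add: card_Diff_subset)
  finally have 1: "card iso \<le> n - card S" .
  have "inj_on su (heads pr - iso)"
    by (rule inj_onI) (metis (mono_tags, lifting) DiffE iso_def mem_Collect_eq pr_su)
  then have "card (heads pr - iso) = card (su ` (heads pr - iso))" by (simp add: card_image)
  also have "\<dots> \<le> card ({1..n} - heads pr)"
  proof (rule card_mono)
    show "su ` (heads pr - iso) \<subseteq> {1..n} - heads pr"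
    proof
      fix w assume "w \<in> su ` (heads pr - iso)"
      then obtain v where v: "v \<in> heads pr" "su v \<noteq> 0" "w = su v" by (auto simp: iso_def)
      then have "pr w = v" "v \<noteq> 0" using pr_su[of v] by (auto simp: heads_def)
      moreover have "w \<in> {1..n}" using arc_le[OF su_arc[OF v(2)]] v(3) by auto
      ultimately show "w \<in> {1..n} - heads pr" by (simp add: heads_def)
    qed
  qed simp
  also have "\<dots> = n - card (heads pr)"
    by (subst card_Diff_subset) (auto simp: heads_def)
  finally have "card (heads pr - iso) \<le> n - card (heads pr)" .
  moreover have "card (heads pr) \<le> card {1..n}" by (rule card_mono) (auto simp: heads_def)
  moreover have "card (heads pr) = card (heads pr - iso) + card iso"
  proof -
    have "finite (heads pr)" "iso \<subseteq> heads pr" by (auto simp: heads_def iso_def)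
    then show ?thesis using card_mono[of "heads pr" iso] by (simp add: card_Diff_subset finite_subset)
  qed
  moreover have "card S \<le> n" using card_mono[OF _ assms] by simp
  ultimately show ?thesis using 1 by simp
qed

text \<open>By optimality of the matching, \<open>card S\<close> is at least \<open>n\<close> minus
  the number of singletons of \<open>Q\<close>. By \<open>heads_bound\<close>, twice the number of
  paths is then at most \<open>n\<close> plus that number, and \<open>singletons_bound\<close>
  applies.\<close>

lemma paths_optimal:
  assumes act: "active own d ptr (Suc n) 0" and S: "S = range own - {0}"
    and Q: "k_path_partition k (with_proj G) Q" and k: "2 \<le> k"
  shows "2 * card (set (paths_below su pr (Suc n))) \<le> k * card Q"
proof -
  let ?T = "{1..n} - Suc ` {v. [v] \<in> Q}"
  obtain g where g: "inj_on g ?T"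
    "\<forall>v\<in>?T. \<exists>c\<in>{1..2 * m}. cell_vertex es c = v \<and> cell_slot n es c = g v"
    using partition_slots[OF Q] by blast
  have "card ?T \<le> card S" unfolding S by (rule matching_optimal[OF act g(1)]) (use g(2) in blast)+
  moreover have Sn: "S \<subseteq> {1..n}" using active_bounds(3)[OF act] unfolding S by (auto simp: Suc_le_eq)
  have sub: "Suc ` {v. [v] \<in> Q} \<subseteq> {1..n}"
    using Q by (auto simp: k_path_partition_def vpath_def vwalk_def pverts_G)
  have "card (Suc ` {v. [v] \<in> Q}) = card {v. [v] \<in> Q}" by (rule card_image) simp
  moreover have "card ?T = n - card (Suc ` {v. [v] \<in> Q})"
    using sub by (subst card_Diff_subset) (auto intro: finite_subset)
  moreover note heads_bound[OF Sn] singletons_bound[OF Q k]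
  moreover have "card (set (paths_below su pr (Suc n))) = card (heads pr)"
    unfolding set_paths using inj_path_from by (rule card_image)
  ultimately show ?thesis by linarith
qed

end

end

section \<open>Composition of the phases and the final bounds\<close>

definition partition_prog :: com where
  "partition_prog = Seq build_prog (Seq match_prog (Seq orient_prog
    (Seq repair_prog (Seq cut_prog emit_prog))))"

context path_input
begin

lemma partition_prog_correct:
  assumes k: "3 \<le> k"
  shows "wp W partition_prog (\<lambda>s T. distinct (output_paths s) \<and>
      k_path_partition k (with_proj G) (set (output_paths s)) \<and>
      (\<forall>Q. k_path_partition k (with_proj G) Q \<longrightarrow>
        2 * card (set (output_paths s)) \<le> k * card Q))
    (input_store n es) (36 * (m * (n + 2)) + 12 * m + 46 * n + 16)"
    (is "wp W _ ?Q _ ?T")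
proof -
  \<comment> \<open>The budgets are accumulated from the last phase backwards: each phase must leave
    the next of these amounts to its successors.\<close>
  let ?T5 = "16 * n + 4"
  let ?T4 = "6 * n + 2 + ?T5"
  let ?T3 = "11 * n + 2 + ?T4"
  let ?T2 = "7 * n + 4 + ?T3"
  let ?T1 = "18 * (2 * m * levels) + 6 * n + 2 + ?T2"
  have "12 * m + 2 + ?T1 \<le> ?T" by (simp add: levels_def algebra_simps)
  then show ?thesis
    unfolding partition_prog_def wp_Seq
  proof (rule build_prog_correct[OF refl])
    fix s :: store and T :: nat
    assume "cells_upto (2 * m) s" "zero_arrays s" "match_arrays_zero s" "?T1 \<le> T"
    then show "wp W match_prog (wp W orient_prog (wp W repair_prog (wp W cut_prog
      (wp W emit_prog ?Q)))) s T"
    proof (rule match_prog_correct)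
      fix s :: store and T :: nat
      assume mat: "matching s (Suc n) 0" and T: "?T2 \<le> T"
      define own d ptr where
        "own = arr s ''own''" and "d = arr s ''lab''" and "ptr = arr s ''ptr''"
      define S where "S = range own - {0}"
      have act: "active own d ptr (Suc n) 0"
        using mat unfolding matching_def own_def d_def ptr_def by blast
      have Sn: "S \<subseteq> {1..n}"
        using active_bounds(3)[OF act] unfolding S_def by (auto simp: Suc_le_eq)
      from mat own_def T show "wp W orient_prog (wp W repair_prog (wp W cut_prog
        (wp W emit_prog ?Q))) s T"
      proof (rule orient_prog_correct, fold S_def)
        fix s :: store and T :: nat
        assume "reg s ''n'' = n" "arr s ''start'' 0 = 0" "linked (arr s ''su'') (arr s ''pr'')"
          "backup (arr s ''su'') (arr s ''fo'') S" "?T3 \<le> T"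
        from this(1-4) Sn this(5)
        show "wp W repair_prog (wp W cut_prog (wp W emit_prog ?Q)) s T"
        proof (rule repair_prog_correct)
          fix s :: store and T :: nat
          assume "reg s ''n'' = n" "arr s ''start'' 0 = 0"
            "cutting (arr s ''su'') (arr s ''pr'') S 1" "?T4 \<le> T"
          from this(1-3) loop_free this(4) show "wp W cut_prog (wp W emit_prog ?Q) s T"
          proof (rule cut_prog_correct)
            fix s :: store and T :: nat
            assume s: "reg s ''n'' = n" "arr s ''start'' 0 = 0"
              and cut: "cutting (arr s ''su'') (arr s ''pr'') S (Suc n)" and T: "?T5 \<le> T"
            from s refl refl linked[OF cut] show "wp W emit_prog ?Q s T"
            proof (rule emit_prog_correct[where R = 0])
              fix s' T'
              assume "output_paths s' = paths_below (arr s ''su'') (arr s ''pr'') (Suc n)"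
              then show "?Q s' T'"
                using distinct_paths[OF cut] paths_partition[OF cut k]
                  paths_optimal[OF cut act S_def] k by simp
            qed (use T in simp)
          qed
        qed
      qed
    qed
  qed
qed

end

theorem theorem1:
  fixes k :: nat
  assumes "k \<ge> 3"
  shows "\<exists>(prog :: com) (C :: nat) (d :: nat).
    \<forall>(G :: nat pair_pre_digraph) n m es.
      pair_digraph G \<and> pverts G = {..<n} \<and> card (parcs G) = m \<and> arcs_listing G es \<longrightarrow>
      (\<exists>t s.
        exec ((n + m + 2) ^ d) prog (input_store n es) t s \<and>
        t \<le> C * (max 1 n * max 1 m) \<and>
        distinct (output_paths s) \<and>
        k_path_partition k (with_proj G) (set (output_paths s)) \<and>
        (\<forall>Q. min_k_path_partition k (with_proj G) Q \<longrightarrow>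
          real (card (set (output_paths s))) \<le> real k / 2 * real (card Q)))"
\<comment> \<open>One program serves every \<open>k \<ge> 3\<close>, since its paths have order at
  most 3.\<close>
proof (rule exI[of _ partition_prog], rule exI[of _ 200], rule exI[of _ 3], intro allI impI)
  fix G :: "nat pair_pre_digraph" and n m es
  assume asm: "pair_digraph G \<and> pverts G = {..<n} \<and> card (parcs G) = m \<and> arcs_listing G es"
  then have es: "set es = parcs G" and m: "m = length es"
    unfolding arcs_listing_def by (blast, metis distinct_card)
  let ?W = "(n + m + 2) ^ 3"
  interpret path_input n es ?W G
  proof (intro path_input.intro arc_input.intro path_input_axioms.intro)
    have wf: "pair_wf_digraph G"
      using asm pair_digraph.axioms(1) pair_fin_digraph.axioms(1) by blast
    fix j assume "j < length es"
    then have "es ! j \<in> parcs G" unfolding es[symmetric] by simp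
    with asm show "fst (es ! j) < n \<and> snd (es ! j) < n"
      using pair_wf_digraph.arc_fst_in_verts[OF wf] pair_wf_digraph.arc_snd_in_verts[OF wf]
      by auto
  next
    \<comment> \<open>As the base is at least 2, its square supplies the factor 4; this is why the
      exponent 3 suffices.\<close>
    have "2 ^ 2 * (n + m + 2) \<le> (n + m + 2) ^ 2 * (n + m + 2)"
      by (intro mult_right_mono power_mono) auto
    then show "4 * n + 4 * length es + 8 \<le> ?W"
      by (simp add: m power2_eq_square power3_eq_cube)
  qed (use asm es in simp_all)
  obtain t s where exec: "exec ?W partition_prog (input_store n es) t s"
    and t: "t \<le> 36 * (m * (n + 2)) + 12 * m + 46 * n + 16"
    and out: "distinct (output_paths s)" "k_path_partition k (with_proj G) (set (output_paths s))"
    and opt: "\<And>Q. k_path_partition k (with_proj G) Q \<Longrightarrow>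
      2 * card (set (output_paths s)) \<le> k * card Q"
    using partition_prog_correct[OF assms] unfolding wp_def m by blast
  \<comment> \<open>Bounding \<open>n\<close> and \<open>m\<close> by numbers that are at least 1
    absorbs the lower-order terms. With \<open>n + 2 \<le> 3 * N\<close> the total is at most
    \<open>(108 + 12 + 46 + 16) * (N * M)\<close>, within the constant 200.\<close>
  define N M where "N = max 1 n" and "M = max 1 m"
  have "n \<le> N" "m \<le> M" "1 \<le> N" "1 \<le> M" by (auto simp: N_def M_def)
  then have "m * (n + 2) \<le> M * (3 * N)" "m \<le> N * M" "n \<le> N * M" "1 \<le> N * M"
    using mult_le_mono[of m M "n + 2" "3 * N"] mult_le_mono[of 1 N m M] mult_le_mono[of n N 1 M]
      mult_le_mono[of 1 N 1 M] by auto
  moreover have "M * (3 * N) = 3 * (N * M)" by simp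
  ultimately have "t \<le> 200 * (N * M)" using t by linarith
  moreover have "real (card (set (output_paths s))) \<le> real k / 2 * real (card Q)"
    if "min_k_path_partition k (with_proj G) Q" for Q
  proof -
    have "2 * card (set (output_paths s)) \<le> k * card Q"
      using that opt unfolding min_k_path_partition_def by blast
    then have "real (2 * card (set (output_paths s))) \<le> real (k * card Q)" by (rule of_nat_mono)
    then show ?thesis by simp
  qed
  ultimately show "\<exists>t s. exec ?W partition_prog (input_store n es) t s \<and>
        t \<le> 200 * (max 1 n * max 1 m) \<and>
        distinct (output_paths s) \<and>
        k_path_partition k (with_proj G) (set (output_paths s)) \<and>
        (\<forall>Q. min_k_path_partition k (with_proj G) Q \<longrightarrow>
          real (card (set (output_paths s))) \<le> real k / 2 * real (card Q))"
    using exec out unfolding N_def M_def by blast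
qed

end
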